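(* Let $\mathcal P_8$ be the family of all planar graphs with girth at least $8$. Then $\chi_p(\mathcal P_8)=4$.
   Context: The girth of a graph is the length of its shortest cycle (infinite for forests). An oriented graph is a directed graph with no loops and no pair of opposite arcs; an orientation of an undirected simple graph $G$ is obtained by orienting each edge. A homomorphism of oriented graphs $\vec G\to\vec H$ is a vertex map sending every arc $uv$ to an arc $\varphi(u)\varphi(v)$. To push a vertex means to reverse all arcs incident with it; the push graph $[\vec G]$ is the set of oriented graphs obtainable from $\vec G$ by pushing some set of vertices (its presentations). $[\vec G]$ admits a homomorphism to $\vec H$ if some presentation does. The push chromatic number $\chi_p([\vec G])$ is the minimum number of vertices of an oriented graph $\vec H$ with $[\vec G]\to\vec H$; $\chi_p(G)$ is the maximum of $\chi_p([\vec G])$ over all orientations $\vec G$ of $G$; for a family $\mathcal F$, $\chi_p(\mathcal F)$ is the maximum of $\chi_p(G)$ over $G\in\mathcal F$. *)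

theory Defs
  imports "HOL-Analysis.Analysis"
begin

definition simple_graph :: "'a set \<Rightarrow> 'a set set \<Rightarrow> bool" where
  "simple_graph V E \<longleftrightarrow> finite V \<and>
     (\<forall>e\<in>E. \<exists>u v. u \<noteq> v \<and> u \<in> V \<and> v \<in> V \<and> e = {u, v})"

definition girth_at_least :: "'a set \<Rightarrow> 'a set set \<Rightarrow> nat \<Rightarrow> bool" where
  "girth_at_least V E g \<longleftrightarrow>
     (\<forall>cs. distinct cs \<and> length cs \<ge> 3 \<and> set cs \<subseteq> V \<and>
        (\<forall>i < length cs. {cs ! i, cs ! ((i + 1) mod length cs)} \<in> E)
        \<longrightarrow> length cs \<ge> g)"

definition planar :: "'a set \<Rightarrow> 'a set set \<Rightarrow> bool" where
  "planar V E \<longleftrightarrow>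
     (\<exists>(p :: 'a \<Rightarrow> complex) (\<gamma> :: 'a set \<Rightarrow> real \<Rightarrow> complex).
        inj_on p V \<and>
        (\<forall>e\<in>E. arc (\<gamma> e) \<and>
           (\<exists>u v. e = {u, v} \<and> pathstart (\<gamma> e) = p u \<and> pathfinish (\<gamma> e) = p v) \<and>
           path_image (\<gamma> e) \<inter> p ` V \<subseteq> p ` e) \<and>
        (\<forall>e\<in>E. \<forall>e'\<in>E. e \<noteq> e' \<longrightarrow>
           path_image (\<gamma> e) \<inter> path_image (\<gamma> e') \<subseteq> p ` (e \<inter> e')))"

definition orientation_of :: "'a set set \<Rightarrow> ('a \<times> 'a) set \<Rightarrow> bool" where
  "orientation_of E A \<longleftrightarrow>
     (\<forall>(u, v)\<in>A. {u, v} \<in> E \<and> (v, u) \<notin> A) \<and>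
     (\<forall>u v. {u, v} \<in> E \<longrightarrow> (u, v) \<in> A \<or> (v, u) \<in> A)"

definition oriented_graph :: "'b set \<Rightarrow> ('b \<times> 'b) set \<Rightarrow> bool" where
  "oriented_graph W B \<longleftrightarrow> B \<subseteq> W \<times> W \<and>
     (\<forall>(x, y)\<in>B. x \<noteq> y \<and> (y, x) \<notin> B)"

definition push :: "'a set \<Rightarrow> ('a \<times> 'a) set \<Rightarrow> ('a \<times> 'a) set" where
  "push S A = {(u, v). (u, v) \<in> A \<and> (u \<in> S \<longleftrightarrow> v \<in> S)}
            \<union> {(v, u) | u v. (u, v) \<in> A \<and> \<not> (u \<in> S \<longleftrightarrow> v \<in> S)}"

definition oriented_hom :: "'a set \<Rightarrow> ('a \<times> 'a) set \<Rightarrow> 'b set \<Rightarrow> ('b \<times> 'b) set \<Rightarrow> ('a \<Rightarrow> 'b) \<Rightarrow> bool" where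
  "oriented_hom V A W B f \<longleftrightarrow> f ` V \<subseteq> W \<and> (\<forall>(u, v)\<in>A. (f u, f v) \<in> B)"

text \<open>Push chromatic number of the push graph [(V,A)]: least number of vertices of an
  oriented graph H (w.l.o.g. on natural numbers) to which some presentation maps.\<close>
definition push_chromatic_or :: "'a set \<Rightarrow> ('a \<times> 'a) set \<Rightarrow> nat" where
  "push_chromatic_or V A = (LEAST k. \<exists>(W :: nat set) B S f.
     finite W \<and> card W = k \<and> oriented_graph W B \<and> S \<subseteq> V \<and>
     oriented_hom V (push S A) W B f)"

definition push_chromatic :: "'a set \<Rightarrow> 'a set set \<Rightarrow> nat" where
  "push_chromatic V E = Max {push_chromatic_or V A | A. orientation_of E A}"

end

theory Submission
  imports Defs
begin

text \<open>Colour the vertices by pairs of a vertex of a 4-vertex tournament and a sign recording whether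
  the vertex is pushed. The tournament is chosen as a skew conference matrix: then a coloured
  neighbour leaves 3 of the 8 colours, while a coloured vertex at the other end of a path through a
  vertex of degree 2 forbids just one. Hence a vertex all of whose neighbours but at most one have
  degree 2 can be coloured last, together with these (at most two) neighbours; a discharging
  argument finds such a vertex whenever 3|E| < 4|V|. This inequality holds for planar graphs of girth
  at least 8 by Euler's formula, which is derived from the Jordan curve theorem (for the number of
  faces) and Janiszewski's theorem (for their boundaries).

  For the lower bound, in a push homomorphism to an oriented graph on three vertices opposite
  vertices of an 8-cycle with an odd number of forward arcs get distinct images. Replacing edges
  of the complete graph on four vertices by such 8-cycles gives a contradiction.\<close>

section \<open>Arcs and complementary components in the plane\<close>

text \<open>Why 8/3: Euler's inequality E + 2 \<le> F + V and the double count 8F \<le> 2E give 3E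
  \<le> 4V - 8, an average degree below 8/3. This is the value that discharging secures in the
  absence of a reducible vertex: a vertex of degree 2 ends with 2 + 2/3, one of degree 3 pays at
  most once and keeps 3 - 1/3, and one of degree d \<ge> 4 keeps at least 2d/3.

  Why 8-cycles: all tournaments on three vertices are equivalent up to pushing and isomorphism, so
  one target serves them all, the integers modulo 6 with \<open>a + 3\<close> as the pushed copy of
  \<open>a\<close>. The image vertex is then the residue modulo 3. A single path of length 4 can
  identify its ends modulo 3. Two such paths with opposite parities of forward arcs cannot: on that
  assumption one forces the difference 0 modulo 6 and the other forces 3. Four vertices that must
  differ pairwise modulo 3 exceed the three residues.\<close>

text \<open>By invariance of dimension: the inverse of the parametrisation would embed a non-empty
  open subset of the plane into the line.\<close>

lemma interior_arc_empty:
  fixes g :: "real \<Rightarrow> complex"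
  assumes "arc g"
  shows "interior (path_image g) = {}"
proof (rule ccontr)
  assume ne: "interior (path_image g) \<noteq> {}"
  obtain h where h: "homeomorphism {0..1} (path_image g) g h"
    using homeomorphism_arc[OF assms] by blast
  have "continuous_on (interior (path_image g)) h"
    using h interior_subset unfolding homeomorphism_def by (metis continuous_on_subset)
  moreover have "inj_on h (interior (path_image g))"
    using h interior_subset unfolding homeomorphism_def
    by (metis (no_types, lifting) inj_onI subsetD)
  ultimately have "DIM(complex) \<le> DIM(real)"
    using invariance_of_dimension ne open_interior by blast
  then show False by simp
qed

text \<open>Drawing one more arc destroys no face, since an open set cannot be covered by an
  arc.\<close>

lemma component_contains_component_after_arc:
  fixes g :: "real \<Rightarrow> complex"
  assumes "arc g" "closed Y" "D \<in> components (- Y)"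
  shows "\<exists>D' \<in> components (- (Y \<union> path_image g)). D' \<subseteq> D"
proof -
  have "open D" using assms open_components by blast
  moreover have "D \<noteq> {}" using assms in_components_nonempty by blast
  ultimately have "\<not> D \<subseteq> path_image g"
    using interior_arc_empty[OF assms(1)] by (metis interior_maximal subset_empty)
  then obtain x where x: "x \<in> D" "x \<notin> path_image g" by blast
  have xY: "x \<notin> Y" using x assms in_components_subset by blast
  let ?D = "connected_component_set (- (Y \<union> path_image g)) x"
  have "?D \<in> components (- (Y \<union> path_image g))"
    using x xY by (auto simp: components_def)
  moreover have "?D \<subseteq> D"
  proof (rule components_maximal[OF assms(3)])
    show "?D \<subseteq> - Y" using connected_component_subset by fastforce
    show "D \<inter> ?D \<noteq> {}"
      using x xY by (metis ComplI IntI UnE connected_component_refl emptyE mem_Collect_eq)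
  qed auto
  ultimately show ?thesis by blast
qed

text \<open>The arc is closed by an arc inside \<open>Y\<close>. That the curve meets
  \<open>Y\<close> in a connected set, namely this second arc, is what Janiszewski's theorem will
  ask for.\<close>

lemma arc_closes_up_to_Jordan_curve:
  fixes g :: "real \<Rightarrow> complex"
  assumes "arc g" and gY: "path_image g \<inter> Y = {pathstart g, pathfinish g}"
    and "path_component Y (pathstart g) (pathfinish g)"
  obtains c where "simple_path c" "pathfinish c = pathstart c" "path_image g \<subseteq> path_image c"
    "path_image c \<subseteq> path_image g \<union> Y" "connected (path_image c \<inter> Y)"
proof -
  obtain h where h: "path h" "path_image h \<subseteq> Y" "pathstart h = pathstart g" "pathfinish h = pathfinish g"
    using assms(3) unfolding path_component_def by blast
  have ne: "pathstart g \<noteq> pathfinish g" using arc_distinct_ends[OF assms(1)] by simp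
  obtain q where q: "arc q" "path_image q \<subseteq> path_image h" "pathstart q = pathstart g" "pathfinish q = pathfinish g"
    using path_contains_arc[OF h(1,3,4) ne] by blast
  define c where "c = g +++ reversepath q"
  have qY: "path_image q \<subseteq> Y" using q h by blast
  have im: "path_image c = path_image g \<union> path_image q"
    unfolding c_def using q by (simp add: path_image_join)
  have "simple_path c" unfolding c_def
    using q qY gY by (intro simple_path_join_loop) (auto simp: arc_reversepath assms(1))
  moreover have "pathfinish c = pathstart c" by (simp add: c_def q)
  moreover have "path_image g \<inter> Y \<subseteq> path_image q"
    using gY q(3,4) pathstart_in_path_image[of q] pathfinish_in_path_image[of q] by simp
  then have "path_image c \<inter> Y = path_image q" using im qY by blast
  then have "connected (path_image c \<inter> Y)"
    using q by (simp add: arc_imp_path connected_path_image)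
  ultimately show ?thesis using that im qY by blast
qed

lemma connected_subset_inside_or_outside:
  fixes c :: "real \<Rightarrow> complex"
  assumes "simple_path c" "pathfinish c = pathstart c" "connected D" "D \<subseteq> - path_image c"
  shows "D \<subseteq> inside (path_image c) \<or> D \<subseteq> outside (path_image c)"
proof -
  note J = Jordan_inside_outside[OF assms(1,2)]
  have o: "open (inside (path_image c))" "open (outside (path_image c))" using J by simp_all
  have e: "inside (path_image c) \<inter> outside (path_image c) \<inter> D = {}" by simp
  have s: "D \<subseteq> inside (path_image c) \<union> outside (path_image c)" using J assms(4) by simp
  show ?thesis using connectedD[OF assms(3) o e s] s by blast
qed

text \<open>The split face is the one containing an inner point of the arc. It has points on both
  sides of the Jordan curve, and once the arc is drawn no component can cross that curve.\<close>

lemma arc_splits_component: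
  fixes g :: "real \<Rightarrow> complex"
  assumes "arc g" "closed Y" and gY: "path_image g \<inter> Y = {pathstart g, pathfinish g}"
    and "path_component Y (pathstart g) (pathfinish g)"
  obtains D D1 D2 where "D \<in> components (- Y)" "D1 \<in> components (- (Y \<union> path_image g))"
    "D2 \<in> components (- (Y \<union> path_image g))" "D1 \<noteq> D2" "D1 \<subseteq> D" "D2 \<subseteq> D"
proof -
  obtain c where c: "simple_path c" "pathfinish c = pathstart c" "path_image g \<subseteq> path_image c"
    "path_image c \<subseteq> path_image g \<union> Y" "connected (path_image c \<inter> Y)"
    using arc_closes_up_to_Jordan_curve[OF assms(1,3,4)] by blast
  let ?J = "path_image c" and ?Z = "Y \<union> path_image g"
  note J = Jordan_inside_outside[OF c(1,2)]
  define q where "q = g (1/2)"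
  have qg: "q \<in> path_image g" by (simp add: q_def path_image_def)
  have "inj_on g {0..1}" using assms(1) by (simp add: arc_def)
  then have "q \<noteq> pathstart g" "q \<noteq> pathfinish g"
    using inj_onD[of g "{0..1}" "1/2" 0] inj_onD[of g "{0..1}" "1/2" 1]
    by (auto simp: q_def pathstart_def pathfinish_def)
  then have qY: "q \<notin> Y" using gY qg by blast
  define D where "D = connected_component_set (- Y) q"
  have D: "D \<in> components (- Y)" using qY by (auto simp: D_def components_def)
  have oD: "open D" using D assms(2) open_components by blast
  have qD: "q \<in> D" using qY by (simp add: D_def)
  \<comment> \<open>By Jordan's theorem inside and outside both have the whole curve as frontier, so
    each accumulates at \<open>q\<close> and meets its open neighbourhood \<open>D\<close>.\<close>
  have side: "\<exists>x \<in> D. x \<in> U" if "frontier U = ?J" for U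
  proof -
    have "q \<in> closure U" using that qg c(3) by (auto simp: frontier_def)
    then show ?thesis using oD qD by (meson disjoint_iff open_Int_closure_eq_empty)
  qed
  obtain x where x: "x \<in> D" "x \<in> inside ?J" using side[of "inside ?J"] J by auto
  obtain y where y: "y \<in> D" "y \<in> outside ?J" using side[of "outside ?J"] J by auto
  have xyJ: "x \<notin> ?J" "y \<notin> ?J"
    using x(2) y(2) inside_no_overlap[of ?J] outside_no_overlap[of ?J] by blast+
  have xyZ: "x \<notin> ?Z" "y \<notin> ?Z"
    using x y xyJ c(3) in_components_subset[OF D] by auto
  let ?C = "\<lambda>x. connected_component_set (- ?Z) x"
  have sub: "?C z \<subseteq> D" if "z \<in> D" "z \<notin> ?Z" for z
  proof (rule components_maximal[OF D])
    show "?C z \<subseteq> - Y" using connected_component_subset by fastforce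
    show "D \<inter> ?C z \<noteq> {}"
      using that by (metis ComplI IntI connected_component_refl emptyE mem_Collect_eq)
  qed auto
  have "?C x \<noteq> ?C y"
  proof
    assume eq: "?C x = ?C y"
    have sJ: "?C x \<subseteq> - ?J" using c(4) connected_component_subset[of "- ?Z" x] by blast
    have xy: "x \<in> ?C x" "y \<in> ?C x" using xyZ eq by auto
    have "?C x \<subseteq> inside ?J \<or> ?C x \<subseteq> outside ?J"
      using connected_subset_inside_or_outside[OF c(1,2) _ sJ] by simp
    then show False using x(2) y(2) xy inside_Int_outside[of ?J] by blast
  qed
  moreover have "?C x \<in> components (- ?Z)" "?C y \<in> components (- ?Z)"
    using xyZ by (auto simp: components_def)
  ultimately show ?thesis
    using that[OF D _ _ _ sub[OF x(1) xyZ(1)] sub[OF y(1) xyZ(2)]] by blast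
qed

text \<open>At most one such component lies on each side of the Jordan curve through the arc. Two on
  the same side are joined off the curve through that side, and off \<open>Y\<close> through the
  open arc \<open>I\<close>; Janiszewski's theorem then joins them off both.\<close>

lemma arc_borders_at_most_two_components:
  fixes g :: "real \<Rightarrow> complex"
  assumes "arc g" "closed Y" and gY: "path_image g \<inter> Y = {pathstart g, pathfinish g}"
    and "path_component Y (pathstart g) (pathfinish g)"
  defines "\<B> \<equiv> {D \<in> components (- (Y \<union> path_image g)).
                   frontier D \<inter> (path_image g - {pathstart g, pathfinish g}) \<noteq> {}}"
  shows "finite \<B>" "card \<B> \<le> 2"
proof -
  obtain c where c: "simple_path c" "pathfinish c = pathstart c" "path_image g \<subseteq> path_image c"
    "path_image c \<subseteq> path_image g \<union> Y" "connected (path_image c \<inter> Y)"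
    using arc_closes_up_to_Jordan_curve[OF assms(1,3,4)] by blast
  let ?J = "path_image c" and ?Z = "Y \<union> path_image g"
  note J = Jordan_inside_outside[OF c(1,2)]
  define I where "I = path_image g - {pathstart g, pathfinish g}"
  have conI: "connected I"
    unfolding I_def using assms(1) by (simp add: arc_imp_simple_path connected_simple_path_endless)
  have IY: "I \<subseteq> - Y" using gY by (auto simp: I_def)
  have side: "D \<subseteq> inside ?J \<or> D \<subseteq> outside ?J" if DB: "D \<in> \<B>" for D
  proof -
    have D: "D \<in> components (- ?Z)" using DB by (simp add: \<B>_def)
    have "D \<subseteq> - ?J" using in_components_subset[OF D] c(4) by blast
    then show ?thesis
      using connected_subset_inside_or_outside[OF c(1,2) in_components_connected[OF D]] by blast
  qed
  have attach: "connected (D \<union> I) \<and> D \<union> I \<subseteq> - Y" if DB: "D \<in> \<B>" for D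
  proof -
    have D: "D \<in> components (- ?Z)" using DB by (simp add: \<B>_def)
    obtain q where q: "q \<in> frontier D" "q \<in> I" using DB unfolding \<B>_def I_def by blast
    have "connected (insert q D)"
    proof (rule connected_intermediate_closure[OF in_components_connected[OF D]])
      show "insert q D \<subseteq> closure D" using q(1) closure_subset[of D] by (simp add: frontier_def)
    qed auto
    then have "connected (insert q D \<union> I)" using conI q(2) by (intro connected_Un) auto
    moreover have "insert q D \<union> I = D \<union> I" using q(2) by blast
    ultimately show ?thesis using in_components_subset[OF D] IY by auto
  qed
  have same: "D1 = D2" if D12: "D1 \<in> \<B>" "D2 \<in> \<B>" and U: "D1 \<subseteq> U" "D2 \<subseteq> U" "connected U" "U \<subseteq> - ?J"
    for D1 D2 U
  proof -
    have C: "D1 \<in> components (- ?Z)" "D2 \<in> components (- ?Z)" using D12 by (auto simp: \<B>_def)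
    obtain x y where xy: "x \<in> D1" "y \<in> D2" using C in_components_nonempty by blast
    have Ine: "I \<noteq> {}" using D12 by (auto simp: \<B>_def I_def)
    have "connected ((D1 \<union> I) \<union> (D2 \<union> I))"
      using attach[OF D12(1)] attach[OF D12(2)] Ine by (intro connected_Un[of "D1 \<union> I" "D2 \<union> I"]) auto
    then have "connected_component (- Y) x y"
      using xy attach[OF D12(1)] attach[OF D12(2)] unfolding connected_component_def
      by (intro exI[of _ "(D1 \<union> I) \<union> (D2 \<union> I)"]) simp
    moreover have "connected_component (- ?J) x y"
      using xy U unfolding connected_component_def by blast
    ultimately have "connected_component (- (?J \<union> Y)) x y"
      using c(1,5) assms(2) by (intro Janiszewski) (auto simp: compact_simple_path_image)
    moreover have "?J \<union> Y = ?Z" using c(3,4) by blast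
    ultimately have "connected_component (- ?Z) x y" by simp
    then obtain T where "connected T" "T \<subseteq> - ?Z" "x \<in> T" "y \<in> T"
      unfolding connected_component_def by blast
    then have "D1 \<inter> D2 \<noteq> {}"
      using components_maximal[OF C(1), of T] xy by blast
    then show ?thesis using components_eq[OF C] by blast
  qed
  have inj: "inj_on (\<lambda>D. D \<subseteq> inside ?J) \<B>"
  proof (rule inj_onI)
    fix D1 D2 assume D: "D1 \<in> \<B>" "D2 \<in> \<B>" "(D1 \<subseteq> inside ?J) = (D2 \<subseteq> inside ?J)"
    then consider "D1 \<subseteq> inside ?J" "D2 \<subseteq> inside ?J" | "D1 \<subseteq> outside ?J" "D2 \<subseteq> outside ?J"
      using side by blast
    then show "D1 = D2"
    proof cases
      case 1
      then show ?thesis using same[OF D(1,2) 1] J inside_no_overlap[of ?J] by blast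
    next
      case 2
      then show ?thesis using same[OF D(1,2) 2] J outside_no_overlap[of ?J] by blast
    qed
  qed
  show "finite \<B>" using inj by (rule inj_on_finite) auto
  have "card \<B> \<le> card (UNIV :: bool set)" using inj by (intro card_inj_on_le) auto
  then show "card \<B> \<le> 2" by simp
qed

section \<open>Cycles\<close>

text \<open>The cycles of \<open>girth_at_least\<close>, detached from a vertex set so that they can
  be sought in the border of a face.\<close>

definition cycle_in :: "'a set set \<Rightarrow> 'a list \<Rightarrow> bool" where
  "cycle_in F cs \<longleftrightarrow> distinct cs \<and> length cs \<ge> 3 \<and>
     (\<forall>i < length cs. {cs ! i, cs ! ((i + 1) mod length cs)} \<in> F)"

lemma cycle_in_mono: "cycle_in F cs \<Longrightarrow> F \<subseteq> G \<Longrightarrow> cycle_in G cs"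
  by (auto simp: cycle_in_def)

text \<open>The first vertex of a longest path is a leaf: a further edge there would either prolong
  the path or close a cycle.\<close>

lemma acyclic_has_leaf:
  assumes "finite F" "F \<noteq> {}" and edge: "\<And>e. e \<in> F \<Longrightarrow> \<exists>u v. u \<noteq> v \<and> e = {u, v}"
    and acyclic: "\<nexists>cs. cycle_in F cs"
  shows "\<exists>e\<in>F. \<exists>v\<in>e. \<forall>e'\<in>F. v \<in> e' \<longrightarrow> e' = e"
proof -
  define P where "P = (\<lambda>xs. distinct xs \<and> 2 \<le> length xs \<and> successively (\<lambda>u v. {u, v} \<in> F) xs)"
  have fin: "finite (\<Union>F)" using assms(1) edge by (metis finite.emptyI finite.insertI finite_Union)
  have sub: "set xs \<subseteq> \<Union>F" if "P xs" for xs
  proof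
    fix x assume "x \<in> set xs"
    then obtain i where i: "i < length xs" "x = xs ! i" by (metis in_set_conv_nth)
    have s: "{xs ! j, xs ! Suc j} \<in> F" if "Suc j < length xs" for j
      using \<open>P xs\<close> that by (simp add: P_def successively_conv_nth)
    show "x \<in> \<Union>F"
    proof (cases i)
      case 0
      then show ?thesis using s[of 0] i \<open>P xs\<close> by (auto simp: P_def)
    next
      case (Suc j)
      then show ?thesis using s[of j] i by auto
    qed
  qed
  have bound: "length xs < Suc (card (\<Union>F))" if "P xs" for xs
    using card_mono[OF fin sub[OF that]] that by (simp add: P_def distinct_card)
  obtain e where e: "e \<in> F" using assms(2) by blast
  obtain u v where uv: "u \<noteq> v" "e = {u, v}" using edge[OF e] by blast
  then have "P [u, v]" using e by (simp add: P_def)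
  then obtain xs where xs: "P xs" and max: "\<And>ys. P ys \<Longrightarrow> length ys \<le> length xs"
    using ex_has_greatest_nat[of P "[u, v]" length "Suc (card (\<Union>F))"] bound by blast
  obtain a b r where abr: "xs = a # b # r"
    using xs by (metis P_def Suc_le_length_iff numeral_2_eq_2)
  have ab: "{a, b} \<in> F" using xs abr by (simp add: P_def)
  have "e' = {a, b}" if e': "e' \<in> F" "a \<in> e'" for e'
  proof (rule ccontr)
    assume ne: "e' \<noteq> {a, b}"
    obtain y where y: "e' = {y, a}" "y \<noteq> a" using edge[OF e'(1)] e'(2) by auto
    have "y \<in> set xs"
    proof (rule ccontr)
      assume "y \<notin> set xs"
      then have "P (y # xs)" using xs y e' by (simp add: P_def abr)
      then show False using max by fastforce
    qed
    then obtain j where j: "j < length xs" "y = xs ! j" by (metis in_set_conv_nth)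
    \<comment> \<open>Index 0 is \<open>a\<close> itself and index 1 would make \<open>e'\<close>
      the edge \<open>{a, b}\<close>; hence the closed prefix has at least three vertices.\<close>
    have "j \<noteq> 0" "j \<noteq> 1" using j y ne abr by auto
    then have j2: "2 \<le> j" by simp
    have "cycle_in F (take (Suc j) xs)"
      unfolding cycle_in_def
    proof (intro conjI allI impI)
      show "distinct (take (Suc j) xs)" using xs by (simp add: P_def)
      show "3 \<le> length (take (Suc j) xs)" using j j2 by simp
      fix i assume "i < length (take (Suc j) xs)"
      then have i: "i < Suc j" "i < length xs" by simp_all
      show "{take (Suc j) xs ! i, take (Suc j) xs ! ((i + 1) mod length (take (Suc j) xs))} \<in> F"
      proof (cases "i = j")
        case True
        have "take (Suc j) xs ! j = y" "take (Suc j) xs ! 0 = a" "length (take (Suc j) xs) = Suc j"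
          using j nth_take[of j "Suc j" xs] nth_take[of 0 "Suc j" xs] abr by auto
        then show ?thesis using True y e' by simp
      next
        case False
        then have "Suc i < Suc j" using i by simp
        then show ?thesis using xs j by (simp add: P_def successively_conv_nth min_def)
      qed
    qed
    then show False using acyclic by blast
  qed
  then have "\<forall>e'\<in>F. a \<in> e' \<longrightarrow> e' = {a, b}" by blast
  then show ?thesis by (rule bexI[OF bexI[of _ a] ab]) simp
qed

lemma cycle_edges_inj:
  assumes "cycle_in F cs"
  shows "inj_on (\<lambda>i. {cs ! i, cs ! ((i + 1) mod length cs)}) {..<length cs}"
proof (rule inj_onI)
  let ?n = "length cs"
  fix i j assume ij: "i \<in> {..<?n}" "j \<in> {..<?n}"
    and eq: "{cs ! i, cs ! ((i + 1) mod ?n)} = {cs ! j, cs ! ((j + 1) mod ?n)}"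
  have n: "3 \<le> ?n" and d: "distinct cs" using assms by (auto simp: cycle_in_def)
  have inj: "cs ! a = cs ! b \<longleftrightarrow> a = b" if "a < ?n" "b < ?n" for a b
    using nth_eq_iff_index_eq[OF d that] .
  have step: "(k + 1) mod ?n = (if k + 1 = ?n then 0 else k + 1)" if "k < ?n" for k
    using that by auto
  have "(i + 1) mod ?n < ?n" "(j + 1) mod ?n < ?n" using n by (intro mod_less_divisor; linarith)+
  then have "i = j \<or> (i = (j + 1) mod ?n \<and> (i + 1) mod ?n = j)"
    using eq ij by (auto simp: doubleton_eq_iff inj)
  then show "i = j"
    using step[of i] step[of j] ij n by (auto split: if_splits)
qed

text \<open>An edge of a cycle is not a bridge. Rotating the cycle to start just after the edge
  turns the remaining edges into a walk between its ends.\<close>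

lemma cycle_edge_detour:
  assumes "cycle_in F cs" "i < length cs"
  defines "e \<equiv> {cs ! i, cs ! ((i + 1) mod length cs)}"
  obtains xs where "xs \<noteq> []" "set xs = set cs" "hd xs = cs ! ((i + 1) mod length cs)" "last xs = cs ! i"
    "successively (\<lambda>u v. {u, v} \<in> F - {e}) xs"
proof -
  let ?n = "length cs"
  have n: "3 \<le> ?n" using assms by (auto simp: cycle_in_def)
  define xs where "xs = rotate (Suc i) cs"
  have nth: "xs ! k = cs ! ((Suc i + k) mod ?n)" if "k < ?n" for k
    using nth_rotate[OF that, of "Suc i"] by (simp add: xs_def)
  have len: "length xs = ?n" by (simp add: xs_def)
  have ne: "xs \<noteq> []" using len n by auto
  have "successively (\<lambda>u v. {u, v} \<in> F - {e}) xs"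
    unfolding successively_conv_nth
  proof (intro allI impI)
    fix k assume k: "Suc k < length xs"
    define m where "m = (Suc i + k) mod ?n"
    have m: "m < ?n" unfolding m_def using n by (intro mod_less_divisor) linarith
    have e: "{xs ! k, xs ! Suc k} = {cs ! m, cs ! ((m + 1) mod ?n)}"
      using k len nth[of k] nth[of "Suc k"] by (simp add: m_def mod_simps)
    have "m \<noteq> i"
    proof
      assume "m = i"
      then have "(Suc k + i) mod ?n = (0 + i) mod ?n" using assms(2) by (simp add: m_def add.commute)
      then show False using k len assms(2) by (auto simp: mod_if split: if_splits)
    qed
    then have "{cs ! m, cs ! ((m + 1) mod ?n)} \<noteq> e"
      using inj_onD[OF cycle_edges_inj[OF assms(1)], of m i] m assms(2) by (auto simp: e_def)
    then show "{xs ! k, xs ! Suc k} \<in> F - {e}"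
      using e m assms(1) by (auto simp: cycle_in_def)
  qed
  moreover have "hd xs = cs ! ((i + 1) mod ?n)"
    using ne nth[of 0] len by (cases cs) (auto simp: hd_conv_nth)
  moreover have "last xs = cs ! i"
  proof -
    have "Suc i + (?n - 1) = i + ?n" "?n - 1 < ?n" using n by linarith+
    then have "xs ! (?n - 1) = cs ! i" using nth[of "?n - 1"] assms(2) by simp
    then show ?thesis using ne len by (simp add: last_conv_nth)
  qed
  moreover have "set xs = set cs" by (simp add: xs_def)
  ultimately show ?thesis using that ne by blast
qed

section \<open>Plane graphs of girth eight\<close>

locale plane_graph =
  fixes V :: "'a set" and E :: "'a set set" and p :: "'a \<Rightarrow> complex" and \<gamma> :: "'a set \<Rightarrow> real \<Rightarrow> complex"
  assumes simple: "simple_graph V E"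
    and arc: "e \<in> E \<Longrightarrow> arc (\<gamma> e)"
    and arc_ends: "e \<in> E \<Longrightarrow> \<exists>u v. e = {u, v} \<and> pathstart (\<gamma> e) = p u \<and> pathfinish (\<gamma> e) = p v"
    and arc_vertices: "e \<in> E \<Longrightarrow> path_image (\<gamma> e) \<inter> p ` V \<subseteq> p ` e"
    and arcs_Int: "e \<in> E \<Longrightarrow> e' \<in> E \<Longrightarrow> e \<noteq> e' \<Longrightarrow>
      path_image (\<gamma> e) \<inter> path_image (\<gamma> e') \<subseteq> p ` (e \<inter> e')"
begin

definition edge_pts :: "'a set set \<Rightarrow> complex set" where
  "edge_pts F = (\<Union>e\<in>F. path_image (\<gamma> e))"

text \<open>All vertices are drawn from the start, whatever \<open>F\<close> is, so a new edge
  always meets the old drawing in exactly its two ends.\<close>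

definition pts :: "'a set set \<Rightarrow> complex set" where
  "pts F = p ` V \<union> edge_pts F"

lemma finite_V: "finite V"
  using simple by (simp add: simple_graph_def)

lemma edge_sub: "e \<in> E \<Longrightarrow> e \<subseteq> V"
  using simple by (auto simp: simple_graph_def)

lemma finite_E: "finite E"
  using finite_V edge_sub by (meson PowI finite_Pow_iff finite_subset subsetI)

lemma edgeE:
  assumes "e \<in> E"
  obtains u v where "e = {u, v}" "u \<in> V" "v \<in> V" "u \<noteq> v" "pathstart (\<gamma> e) = p u" "pathfinish (\<gamma> e) = p v"
proof -
  obtain u v where uv: "e = {u, v}" "pathstart (\<gamma> e) = p u" "pathfinish (\<gamma> e) = p v"
    using arc_ends[OF assms] by blast
  moreover have "u \<noteq> v" using arc_distinct_ends[OF arc[OF assms]] uv by auto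
  ultimately show ?thesis using that edge_sub[OF assms] by blast
qed

lemma compact_edge_pts: "F \<subseteq> E \<Longrightarrow> compact (edge_pts F)"
  unfolding edge_pts_def
  by (intro compact_UN finite_subset[OF _ finite_E] compact_arc_image arc) auto

lemma compact_pts: "F \<subseteq> E \<Longrightarrow> compact (pts F)"
  unfolding pts_def
  by (intro compact_Un compact_edge_pts finite_imp_compact finite_imageI finite_V)

lemma pts_insert: "pts (insert e F) = pts F \<union> path_image (\<gamma> e)"
  by (auto simp: pts_def edge_pts_def)

lemma arc_Int_edge_pts:
  assumes "e \<in> E" "F \<subseteq> E" "e \<notin> F"
  shows "path_image (\<gamma> e) \<inter> edge_pts F \<subseteq> p ` (e \<inter> \<Union>F)"
proof
  fix x assume "x \<in> path_image (\<gamma> e) \<inter> edge_pts F"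
  then obtain e' where e': "e' \<in> F" "x \<in> path_image (\<gamma> e) \<inter> path_image (\<gamma> e')"
    by (auto simp: edge_pts_def)
  then have "x \<in> p ` (e \<inter> e')" using arcs_Int[OF assms(1), of e'] assms(2,3) by blast
  then show "x \<in> p ` (e \<inter> \<Union>F)" using e'(1) by blast
qed

lemma ends_eq: "e \<in> E \<Longrightarrow> {pathstart (\<gamma> e), pathfinish (\<gamma> e)} = p ` e"
  using arc_ends[of e] by auto

lemma arc_Int_pts:
  assumes "e \<in> E" "F \<subseteq> E" "e \<notin> F"
  shows "path_image (\<gamma> e) \<inter> pts F = {pathstart (\<gamma> e), pathfinish (\<gamma> e)}"
proof
  have "path_image (\<gamma> e) \<inter> pts F \<subseteq> p ` e"
    using arc_Int_edge_pts[OF assms] arc_vertices[OF assms(1)] unfolding pts_def by blast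
  then show "path_image (\<gamma> e) \<inter> pts F \<subseteq> {pathstart (\<gamma> e), pathfinish (\<gamma> e)}"
    using ends_eq[OF assms(1)] by simp
  have "p ` e \<subseteq> pts F" using edge_sub[OF assms(1)] unfolding pts_def by blast
  then show "{pathstart (\<gamma> e), pathfinish (\<gamma> e)} \<subseteq> path_image (\<gamma> e) \<inter> pts F"
    using ends_eq[OF assms(1)] pathstart_in_path_image[of "\<gamma> e"] pathfinish_in_path_image[of "\<gamma> e"]
    by blast
qed

lemma path_component_edge:
  assumes "{u, v} \<in> F" "F \<subseteq> E"
  shows "path_component (pts F) (p u) (p v)"
proof -
  have e: "{u, v} \<in> E" using assms by blast
  have "path_component (pts F) (pathstart (\<gamma> {u, v})) (pathfinish (\<gamma> {u, v}))"
    unfolding path_component_def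
    using arc_imp_path[OF arc[OF e]] assms(1)
    by (intro exI[of _ "\<gamma> {u, v}"]) (auto simp: pts_def edge_pts_def)
  moreover have "{pathstart (\<gamma> {u, v}), pathfinish (\<gamma> {u, v})} = {p u, p v}" using ends_eq[OF e] by simp
  ultimately show ?thesis by (metis doubleton_eq_iff path_component_sym)
qed

lemma path_component_mono_edges:
  assumes "path_component (pts F) x y" "F \<subseteq> G"
  shows "path_component (pts G) x y"
proof (rule path_component_of_subset[OF _ assms(1)])
  show "pts F \<subseteq> pts G" using assms(2) by (auto simp: pts_def edge_pts_def)
qed

lemma path_component_walk:
  assumes "F \<subseteq> E" "xs \<noteq> []" "set xs \<subseteq> V" "successively (\<lambda>u v. {u, v} \<in> F) xs"
  shows "path_component (pts F) (p (hd xs)) (p (last xs))"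
  using assms(2-)
proof (induction xs rule: induct_list012)
  case (2 x)
  then show ?case by (auto simp: pts_def intro: path_component_refl)
next
  case (3 x y zs)
  then have "path_component (pts F) (p y) (p (last (y # zs)))" by simp
  moreover have "path_component (pts F) (p x) (p y)"
    using 3 assms(1) by (intro path_component_edge) auto
  ultimately show ?case using path_component_trans by fastforce
qed auto

section \<open>Counting faces: Euler's formula as an inequality\<close>

text \<open>Induction over the edges. Equal labels promise a connection in the drawing, so an edge
  between them closes a curve and splits a face; an edge between different labels merges the labels
  and loses no face. Keeping some finite family \<open>\<C>\<close> avoids proving that there are
  finitely many faces.\<close>

lemma faces_lower_bound:
  assumes "F \<subseteq> E"
  shows "\<exists>(l :: 'a \<Rightarrow> 'a) \<C>. finite \<C> \<and> \<C> \<subseteq> components (- pts F) \<and>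
    (\<forall>u\<in>V. \<forall>v\<in>V. l u = l v \<longrightarrow> path_component (pts F) (p u) (p v)) \<and>
    card F + card (l ` V) + 1 \<le> card \<C> + card V"
  using finite_subset[OF assms finite_E] assms
proof (induction F rule: finite_induct)
  case empty
  have "pts {} \<noteq> UNIV" using compact_pts[of "{}"] not_compact_UNIV by auto
  then obtain C where "C \<in> components (- pts {})" by (metis Compl_empty_eq components_eq_empty double_complement ex_in_conv)
  then show ?case
    by (intro exI[of _ id] exI[of _ "{C}"]) (auto simp: pts_def edge_pts_def intro: path_component_refl)
next
  case (insert e F)
  have F: "F \<subseteq> E" and e: "e \<in> E" using insert.prems by auto
  obtain l :: "'a \<Rightarrow> 'a" and \<C> where fin: "finite \<C>" and \<C>: "\<C> \<subseteq> components (- pts F)"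
    and l': "\<forall>u\<in>V. \<forall>v\<in>V. l u = l v \<longrightarrow> path_component (pts F) (p u) (p v)"
    and count: "card F + card (l ` V) + 1 \<le> card \<C> + card V"
    using insert.IH[OF F] by blast
  note l = l'[rule_format]
  obtain u v where uv: "e = {u, v}" "u \<in> V" "v \<in> V" "u \<noteq> v" "pathstart (\<gamma> e) = p u" "pathfinish (\<gamma> e) = p v"
    using edgeE[OF e] by blast
  have cl: "closed (pts F)" using compact_pts[OF F] compact_imp_closed by blast
  let ?Z = "pts (insert e F)"
  \<comment> \<open>A choice of one new face inside each old face; it is injective because old faces
    are disjoint.\<close>
  have "\<forall>D\<in>components (- pts F). \<exists>D'. D' \<in> components (- ?Z) \<and> D' \<subseteq> D"
    using component_contains_component_after_arc[OF arc[OF e] cl] unfolding pts_insert by blast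
  then obtain h where h: "\<And>D. D \<in> components (- pts F) \<Longrightarrow> h D \<in> components (- ?Z) \<and> h D \<subseteq> D"
    by metis
  have injh: "inj_on h (components (- pts F))"
  proof (rule inj_onI)
    fix C D assume CD: "C \<in> components (- pts F)" "D \<in> components (- pts F)" "h C = h D"
    then have "h C \<noteq> {}" "h C \<subseteq> C" "h C \<subseteq> D" using h in_components_nonempty by metis+
    then show "C = D" using components_eq[OF CD(1,2)] by blast
  qed
  have mono: "path_component ?Z x y" if "path_component (pts F) x y" for x y
    using path_component_mono_edges[OF that] by blast
  show ?case
  proof (cases "l u = l v")
    case True
    have "path_component (pts F) (pathstart (\<gamma> e)) (pathfinish (\<gamma> e))"
      using l[OF uv(2,3) True] uv by simp
    then obtain D D1 D2 where D: "D \<in> components (- pts F)" "D1 \<in> components (- ?Z)"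
      "D2 \<in> components (- ?Z)" "D1 \<noteq> D2" "D1 \<subseteq> D" "D2 \<subseteq> D"
      using arc_splits_component[OF arc[OF e] cl arc_Int_pts[OF e F insert.hyps(2)]]
      unfolding pts_insert by blast
    \<comment> \<open>Whether or not \<open>D\<close> was in the family, taking it out keeps the two
      halves apart from the other chosen faces, and the size grows by at least one.\<close>
    define \<C>' where "\<C>' = h ` (\<C> - {D}) \<union> {D1, D2}"
    have ne: "D1 \<noteq> {}" "D2 \<noteq> {}" using D in_components_nonempty by blast+
    have "D1 \<notin> h ` (\<C> - {D})" "D2 \<notin> h ` (\<C> - {D})"
    proof -
      have "C \<inter> D = {}" if "C \<in> \<C> - {D}" for C
        using that \<C> D(1) components_nonoverlap by blast
      then show "D1 \<notin> h ` (\<C> - {D})" "D2 \<notin> h ` (\<C> - {D})" using D(5,6) ne h \<C> by blast+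
    qed
    then have "card \<C>' = card (h ` (\<C> - {D})) + 2"
      unfolding \<C>'_def using fin D(4) by (subst card_Un_disjoint) auto
    also have "card (h ` (\<C> - {D})) = card (\<C> - {D})"
      using injh \<C> by (intro card_image) (meson Diff_subset inj_on_subset)
    finally have "card \<C> + 1 \<le> card \<C>'" using fin by (simp add: card_Diff_singleton_if split: if_splits)
    then have "card (insert e F) + card (l ` V) + 1 \<le> card \<C>' + card V"
      using count insert.hyps by simp
    moreover have "\<C>' \<subseteq> components (- ?Z)" "finite \<C>'" using h \<C> D(2,3) fin by (auto simp: \<C>'_def)
    moreover have "\<forall>u\<in>V. \<forall>v\<in>V. l u = l v \<longrightarrow> path_component ?Z (p u) (p v)"
      using l mono by blast
    ultimately show ?thesis by blast
  next
    case False
    \<comment> \<open>The class of \<open>u\<close> is absorbed into that of \<open>v\<close>, so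
      the label of \<open>u\<close> disappears.\<close>
    define l' where "l' = (\<lambda>w. if l w = l u then l v else l w)"
    have euv: "path_component ?Z (p u) (p v)" using path_component_edge[of u v "insert e F"] insert.prems uv(1) by simp
    have to_v: "path_component ?Z (p w) (p v)" if "w \<in> V" "l' w = l v" for w
    proof (cases "l w = l u")
      case True
      then have "path_component ?Z (p w) (p u)" using mono[OF l[OF that(1) uv(2)]] by simp
      then show ?thesis using euv path_component_trans by metis
    next
      case False
      then show ?thesis using mono[OF l[OF that(1) uv(3)]] that(2) by (simp add: l'_def)
    qed
    have pc: "path_component ?Z (p x) (p y)" if "x \<in> V" "y \<in> V" "l' x = l' y" for x y
    proof (cases "l' x = l v")
      case True
      then have "path_component ?Z (p x) (p v)" "path_component ?Z (p y) (p v)"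
        using to_v[OF that(1)] to_v[OF that(2)] that(3) by simp_all
      then show ?thesis using path_component_trans path_component_sym by metis
    next
      case False
      then have "l x = l y" using that by (auto simp: l'_def split: if_splits)
      then show ?thesis using mono[OF l[OF that(1,2)]] by simp
    qed
    have "l' ` V \<subseteq> l ` V - {l u}" using False uv(3) by (auto simp: l'_def)
    then have "card (l' ` V) < card (l ` V)"
      using finite_V uv(2) by (intro psubset_card_mono) auto
    moreover have "card (h ` \<C>) = card \<C>" using injh \<C> by (intro card_image) (rule inj_on_subset)
    ultimately have "card (insert e F) + card (l' ` V) + 1 \<le> card (h ` \<C>) + card V"
      using count insert.hyps by simp
    moreover have "\<forall>u\<in>V. \<forall>v\<in>V. l' u = l' v \<longrightarrow> path_component ?Z (p u) (p v)"
      using pc by blast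
    moreover have "h ` \<C> \<subseteq> components (- ?Z)" "finite (h ` \<C>)" using h \<C> fin by auto
    ultimately show ?thesis by blast
  qed
qed

section \<open>Face boundaries and double counting\<close>

text \<open>Leaf edges are put back one at a time. Each meets the rest in at most one point, a
  connected set, so Janiszewski's theorem keeps the complement connected.\<close>

lemma acyclic_not_separating:
  assumes "F \<subseteq> E" "\<nexists>cs. cycle_in F cs"
  shows "connected (- edge_pts F)"
  using finite_subset[OF assms(1) finite_E] assms
proof (induction "card F" arbitrary: F)
  case 0
  then show ?case by (simp add: edge_pts_def connected_UNIV)
next
  case (Suc n)
  have "\<exists>u v. u \<noteq> v \<and> e = {u, v}" if "e \<in> F" for e
    using that Suc.prems edgeE by (metis subsetD)
  moreover have "F \<noteq> {}" using Suc.hyps(2) by auto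
  ultimately obtain e v where e: "e \<in> F" "v \<in> e" and leaf: "\<And>e'. e' \<in> F \<Longrightarrow> v \<in> e' \<Longrightarrow> e' = e"
    using acyclic_has_leaf[of F] Suc.prems by blast
  let ?F = "F - {e}"
  have eE: "e \<in> E" using e Suc.prems by blast
  obtain u where u: "e = {u, v}" using edgeE[OF eE] e(2) by (metis insert_commute insert_iff singletonD)
  have "connected (- edge_pts ?F)"
    using Suc e cycle_in_mono[of ?F _ F] by (intro Suc.hyps(1)) auto
  moreover have "path_image (\<gamma> e) \<inter> edge_pts ?F \<subseteq> p ` (e \<inter> \<Union>?F)"
    using Suc.prems eE by (intro arc_Int_edge_pts) auto
  then have "path_image (\<gamma> e) \<inter> edge_pts ?F \<subseteq> {p u}" using u leaf by blast
  then have "connected (path_image (\<gamma> e) \<inter> edge_pts ?F)"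
    by (metis connected_empty connected_sing subset_singletonD)
  moreover have "connected (- path_image (\<gamma> e))"
    using connected_arc_complement[OF arc[OF eE]] by simp
  moreover have "closed (edge_pts ?F)" using Suc.prems compact_edge_pts[of ?F] compact_imp_closed by blast
  ultimately have "connected (- (path_image (\<gamma> e) \<union> edge_pts ?F))"
    using compact_arc_image[OF arc[OF eE]] by (intro Janiszewski_connected)
  moreover have "path_image (\<gamma> e) \<union> edge_pts ?F = edge_pts F" using e(1) by (auto simp: edge_pts_def)
  ultimately show ?case by simp
qed

text \<open>The ends are removed so that a face touching an edge merely at a vertex does not
  count.\<close>

definition border :: "complex set \<Rightarrow> 'a set set" where
  "border D = {e \<in> E. frontier D \<inter> (path_image (\<gamma> e) - p ` e) \<noteq> {}}"

text \<open>If the border were acyclic, its complement would be connected even after deleting the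
  finitely many vertices. It contains both faces, hence meets the frontier of \<open>D\<close>,
  which however lies in the border and the vertices. A second face is essential: the only face of a
  forest has no cycle.\<close>

lemma border_has_cycle:
  assumes "D \<in> components (- pts E)" "D' \<in> components (- pts E)" "D \<noteq> D'"
  shows "\<exists>cs. cycle_in (border D) cs"
proof (rule ccontr)
  assume no: "\<not> ?thesis"
  have B: "border D \<subseteq> E" by (auto simp: border_def)
  have "connected (- edge_pts (border D) - p ` V)"
    using acyclic_not_separating[OF B no] compact_edge_pts[OF B] finite_V
    by (intro connected_open_delete_finite) (auto simp: compact_imp_closed open_Compl)
  moreover have "- edge_pts (border D) - p ` V = - pts (border D)" by (auto simp: pts_def)
  ultimately have con: "connected (- pts (border D))" by simp
  have sub: "pts (border D) \<subseteq> pts E" using B by (auto simp: pts_def edge_pts_def)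
  have fr: "frontier D \<subseteq> pts E"
    using assms(1) compact_pts[of E] by (intro frontier_of_components_closed_complement) (auto simp: compact_imp_closed)
  have "frontier D \<subseteq> pts (border D)"
  proof
    fix x assume x: "x \<in> frontier D"
    show "x \<in> pts (border D)"
    proof (cases "x \<in> p ` V")
      case False
      then obtain e where e: "e \<in> E" "x \<in> path_image (\<gamma> e)" using x fr by (auto simp: pts_def edge_pts_def)
      then have "x \<notin> p ` e" using False edge_sub by blast
      then show ?thesis using e x by (auto simp: pts_def edge_pts_def border_def)
    qed (simp add: pts_def)
  qed
  moreover have "- pts (border D) \<inter> frontier D \<noteq> {}"
  proof (rule connected_Int_frontier[OF con])
    have "D \<subseteq> - pts E" "D' \<subseteq> - pts E" "D \<noteq> {}" "D' \<noteq> {}" "D \<inter> D' = {}"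
      using assms in_components_subset in_components_nonempty components_nonoverlap by blast+
    then show "- pts (border D) \<inter> D \<noteq> {}" "- pts (border D) - D \<noteq> {}" using sub by blast+
  qed
  ultimately show False by blast
qed

text \<open>The path assumption says that \<open>e\<close> is not a bridge, so its arc closes up
  through the rest of the drawing.\<close>

lemma card_le_two_borders:
  assumes "e \<in> E" "{u, v} = e" "path_component (pts (E - {e})) (p u) (p v)"
  shows "card {D \<in> components (- pts E). e \<in> border D} \<le> 2"
    and "finite {D \<in> components (- pts E). e \<in> border D}"
proof -
  let ?Y = "pts (E - {e})" and ?g = "\<gamma> e"
  have cl: "closed ?Y" using compact_pts[of "E - {e}"] compact_imp_closed by blast
  have Int: "path_image ?g \<inter> ?Y = {pathstart ?g, pathfinish ?g}"
    using assms(1) by (intro arc_Int_pts) auto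
  have "{pathstart ?g, pathfinish ?g} = {p u, p v}" using ends_eq[OF assms(1)] assms(2) by auto
  then have pc: "path_component ?Y (pathstart ?g) (pathfinish ?g)"
    using assms(3) by (metis doubleton_eq_iff path_component_sym)
  have "?Y \<union> path_image ?g = pts E" using pts_insert[of e "E - {e}"] assms(1) by (simp add: insert_absorb)
  then have eq: "{D \<in> components (- pts E). e \<in> border D} = {D \<in> components (- (?Y \<union> path_image ?g)).
       frontier D \<inter> (path_image ?g - {pathstart ?g, pathfinish ?g}) \<noteq> {}}"
    using ends_eq[OF assms(1)] assms(1) by (simp add: border_def)
  show "card {D \<in> components (- pts E). e \<in> border D} \<le> 2"
    "finite {D \<in> components (- pts E). e \<in> border D}"
    unfolding eq using arc_borders_at_most_two_components[OF arc[OF assms(1)] cl Int pc] by auto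
qed

text \<open>Every face is bounded by a cycle, all of whose edges are non-bridges and hence border at
  most two faces; so double counting needs no statement about face boundaries in general.\<close>
lemma edge_bound_girth_eight:
  assumes girth: "girth_at_least V E 8" and "V \<noteq> {}"
  shows "3 * card E < 4 * card V"
\<comment> \<open>With at least as many edges as vertices Euler's inequality yields two faces, as
  \<open>border_has_cycle\<close> requires; with fewer edges the bound is immediate.\<close>
proof (cases "card E < card V")
  case False
  obtain l :: "'a \<Rightarrow> 'a" and \<C> where fin: "finite \<C>" and \<C>: "\<C> \<subseteq> components (- pts E)"
    and count: "card E + card (l ` V) + 1 \<le> card \<C> + card V"
    using faces_lower_bound[of E] by blast
  have "card (l ` V) \<ge> 1" using assms(2) finite_V by (simp add: Suc_le_eq card_gt_0_iff)
  then have cC: "card E + 2 \<le> card \<C> + card V" using count by linarith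
  then have two: "2 \<le> card \<C>" using False by linarith
  \<comment> \<open>The edges that are not bridges, in the topological form that
    \<open>card_le_two_borders\<close> takes.\<close>
  define N where "N = {e \<in> E. \<exists>u v. e = {u, v} \<and> path_component (pts (E - {e})) (p u) (p v)}"
  have finN: "finite N" using finite_E by (simp add: N_def)
  have ge8: "8 \<le> card {e \<in> N. e \<in> border D}" if D: "D \<in> \<C>" for D
  proof -
    have "\<not> \<C> \<subseteq> {D}" using two card_mono[of "{D}" \<C>] by auto
    then obtain D' where "D' \<in> \<C>" "D \<noteq> D'" by blast
    then obtain cs where cs: "cycle_in (border D) cs" using border_has_cycle[of D D'] D \<C> by blast
    have BE: "border D \<subseteq> E" by (auto simp: border_def)
    let ?e = "\<lambda>i. {cs ! i, cs ! ((i + 1) mod length cs)}"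
    have eB: "?e i \<in> border D" if "i < length cs" for i using cs that by (simp add: cycle_in_def)
    have csV: "set cs \<subseteq> V"
    proof
      fix x assume "x \<in> set cs"
      then obtain i where i: "i < length cs" "x = cs ! i" by (metis in_set_conv_nth)
      then show "x \<in> V" using eB[OF i(1)] BE edge_sub by blast
    qed
    have "8 \<le> length cs"
      using girth csV cs eB BE unfolding girth_at_least_def cycle_in_def by (meson subsetD)
    also have "length cs = card (?e ` {..<length cs})"
      using card_image[OF cycle_edges_inj[OF cs]] by simp
    also have "\<dots> \<le> card {e \<in> N. e \<in> border D}"
    proof (intro card_mono)
      show "?e ` {..<length cs} \<subseteq> {e \<in> N. e \<in> border D}"
      proof (rule image_subsetI)
        fix i assume i: "i \<in> {..<length cs}"
        obtain xs where xs: "xs \<noteq> []" "set xs = set cs" "hd xs = cs ! ((i + 1) mod length cs)" "last xs = cs ! i"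
          "successively (\<lambda>u v. {u, v} \<in> border D - {?e i}) xs"
          using cycle_edge_detour[OF cs, of i] i by auto
        have "successively (\<lambda>u v. {u, v} \<in> E - {?e i}) xs"
          using xs(5) by (rule successively_mono) (use BE in auto)
        then have "path_component (pts (E - {?e i})) (p (cs ! ((i + 1) mod length cs))) (p (cs ! i))"
          using path_component_walk[of "E - {?e i}" xs] xs csV by auto
        moreover have "?e i = {cs ! ((i + 1) mod length cs), cs ! i}" by auto
        moreover have "?e i \<in> border D" using eB[of i] i by simp
        ultimately show "?e i \<in> {e \<in> N. e \<in> border D}"
          using BE unfolding N_def by blast
      qed
    qed (use finN in auto)
    finally show ?thesis .
  qed
  have "8 * card \<C> = (\<Sum>D\<in>\<C>. 8)" by simp
  also have "\<dots> \<le> (\<Sum>D\<in>\<C>. card {e \<in> N. e \<in> border D})" by (intro sum_mono ge8)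
  also have "\<dots> = (\<Sum>e\<in>N. card {D \<in> \<C>. e \<in> border D})"
    using sum.swap_restrict[OF fin finN, of "\<lambda>_ _. 1::nat" "\<lambda>D e. e \<in> border D"] by simp
  also have "\<dots> \<le> (\<Sum>e\<in>N. 2)"
  proof (rule sum_mono)
    fix e assume "e \<in> N"
    then obtain u v where e: "e \<in> E" "{u, v} = e" "path_component (pts (E - {e})) (p u) (p v)"
      by (auto simp: N_def)
    have "card {D \<in> \<C>. e \<in> border D} \<le> card {D \<in> components (- pts E). e \<in> border D}"
      using \<C> card_le_two_borders(2)[OF e] by (intro card_mono) auto
    then show "card {D \<in> \<C>. e \<in> border D} \<le> 2" using card_le_two_borders(1)[OF e] by simp
  qed
  also have "\<dots> \<le> 2 * card E"
    using card_mono[OF finite_E, of N] by (auto simp: N_def)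
  finally show ?thesis using cC by linarith
next
  case True
  then show ?thesis by linarith
qed

end

section \<open>The upper bound\<close>

text \<open>Signs \<open>\<plusminus>1\<close> for the direction of arcs turn this tournament into a skew-symmetric matrix
  with pairwise orthogonal rows.\<close>
definition beats :: "(nat \<times> nat) list" where
  "beats = [(0, 1), (1, 2), (2, 0), (3, 0), (3, 1), (3, 2)]"

definition colours :: "(nat \<times> bool) list" where
  "colours = [(0, False), (1, False), (2, False), (3, False), (0, True), (1, True), (2, True), (3, True)]"

text \<open>The doubled tournament: each vertex gets a twin with all arcs reversed, so that ordinary
  homomorphisms to it encode push homomorphisms to the tournament.\<close>

definition twarc :: "nat \<times> bool \<Rightarrow> nat \<times> bool \<Rightarrow> bool" where
  "twarc x y \<longleftrightarrow> (if snd x = snd y then (fst x, fst y) \<in> set beats else (fst y, fst x) \<in> set beats)"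

text \<open>The flag \<open>d\<close> is the direction of an edge, true if it leaves the vertex
  coloured \<open>x\<close>; this lets one statement treat both orientations.\<close>

definition twrel :: "bool \<Rightarrow> nat \<times> bool \<Rightarrow> nat \<times> bool \<Rightarrow> bool" where
  "twrel d x y \<longleftrightarrow> (if d then twarc x y else twarc y x)"

text \<open>The unique colour that cannot be reached from \<open>x\<close> through a vertex of degree 2.\<close>
definition forb :: "bool \<Rightarrow> bool \<Rightarrow> nat \<times> bool \<Rightarrow> nat \<times> bool" where
  "forb d d' x = (if d = d' then (fst x, \<not> snd x) else x)"

text \<open>Each of the three other tournament vertices fits with exactly one of its two
  signs.\<close>

lemma twrel_check1: "\<forall>x\<in>set colours. \<forall>d\<in>set [False, True]. 3 \<le> length (filter (twrel d x) colours)"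
  by code_simp

text \<open>This is orthogonality of rows. For different tournament vertices the two common columns
  have sign products 1 and -1, so either required product occurs. For equal ones every product is 1,
  which fixes the relative sign and excludes one colour.\<close>

lemma twrel_check2: "\<forall>x\<in>set colours. \<forall>z\<in>set colours. \<forall>d\<in>set [False, True]. \<forall>d'\<in>set [False, True].
    z \<noteq> forb d d' x \<longrightarrow> (\<exists>y\<in>set colours. twrel d x y \<and> twrel d' z y)"
  by code_simp

lemma card_twrel:
  assumes "x \<in> set colours"
  shows "3 \<le> card {c \<in> set colours. twrel d x c}"
proof -
  have "distinct colours" by (simp add: colours_def)
  then have "card {c \<in> set colours. twrel d x c} = length (filter (twrel d x) colours)"
    by (metis distinct_card distinct_filter set_filter)
  then show ?thesis using twrel_check1 assms by (cases d) auto
qed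

lemma twrel_two_path:
  assumes "x \<in> set colours" "z \<in> set colours" "z \<noteq> forb d d' x"
  shows "\<exists>y\<in>set colours. twrel d x y \<and> twrel d' z y"
  using twrel_check2[rule_format, OF assms(1,2), of d d'] assms(3) by (cases d; cases d') simp_all

section \<open>Extending a colouring over a reducible vertex\<close>

definition nb :: "'a set set \<Rightarrow> 'a \<Rightarrow> 'a set" where
  "nb E v = {u. {v, u} \<in> E}"

definition twcol :: "'a set \<Rightarrow> ('a \<times> 'a) set \<Rightarrow> ('a \<Rightarrow> nat \<times> bool) \<Rightarrow> bool" where
  "twcol V A f \<longleftrightarrow> f ` V \<subseteq> set colours \<and> (\<forall>(u, v)\<in>A. twarc (f u) (f v))"

lemma simple_graph_edge:
  assumes "simple_graph V E" "{u, v} \<in> E"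
  shows "u \<in> V" "v \<in> V" "u \<noteq> v"
proof -
  obtain a b where "a \<noteq> b" "a \<in> V" "b \<in> V" "{u, v} = {a, b}"
    using assms unfolding simple_graph_def by blast
  then show "u \<in> V" "v \<in> V" "u \<noteq> v" by (auto simp: doubleton_eq_iff)
qed

lemma finite_nb: "simple_graph V E \<Longrightarrow> finite (nb E v)"
proof (rule finite_subset)
  assume G: "simple_graph V E"
  show "finite V" using G by (simp add: simple_graph_def)
  show "nb E v \<subseteq> V" using simple_graph_edge(2)[OF G] by (auto simp: nb_def)
qed

lemma nb_sym: "u \<in> nb E v \<longleftrightarrow> v \<in> nb E u"
  by (simp add: nb_def insert_commute)

text \<open>The count is 3 > 2: at least three colours suit the neighbour outside \<open>Y\<close>,
  and each of the at most two vertices of \<open>Y\<close> forbids one. Independence of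
  \<open>Y\<close> ensures that the other neighbour \<open>r y\<close> is already coloured.\<close>

lemma extend_colouring:
  assumes G: "simple_graph V E" and A: "orientation_of E A" and v: "v \<in> V"
    and Y: "Y \<subseteq> nb E v" and deg2: "\<And>y. y \<in> Y \<Longrightarrow> card (nb E y) = 2" and "card Y \<le> 2"
    and one: "card (nb E v - Y) \<le> 1" and indep: "\<And>y y'. y \<in> Y \<Longrightarrow> y' \<in> Y \<Longrightarrow> {y, y'} \<notin> E"
    and f': "twcol (V - insert v Y) (A \<inter> (V - insert v Y) \<times> (V - insert v Y)) f'"
  shows "\<exists>f. twcol V A f"
proof -
  let ?V = "V - insert v Y" and ?W = "nb E v - Y"
  note edge = simple_graph_edge[OF G]
  have anti: "(a, b) \<in> A \<longleftrightarrow> (b, a) \<notin> A" if "{a, b} \<in> E" for a b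
    using A that unfolding orientation_of_def by (auto dest!: bspec)
  have AE: "{a, b} \<in> E" if "(a, b) \<in> A" for a b
    using A that unfolding orientation_of_def by auto
  have finY: "finite Y" using Y finite_nb[OF G] finite_subset by blast
  have vY: "v \<notin> Y" using Y edge(3)[of v v] by (auto simp: nb_def)
  have "\<exists>z. nb E y = {v, z} \<and> z \<noteq> v" if y: "y \<in> Y" for y
  proof -
    have "v \<in> nb E y" using y Y nb_sym by fast
    then have "card (nb E y - {v}) = 1" using deg2[OF y] by simp
    then obtain z where z: "nb E y - {v} = {z}" by (rule card_1_singletonE)
    then have "nb E y = {v, z}" using \<open>v \<in> nb E y\<close> by blast
    moreover have "z \<noteq> v" using z by blast
    ultimately show ?thesis by blast
  qed
  then obtain r where r: "\<And>y. y \<in> Y \<Longrightarrow> nb E y = {v, r y}" "\<And>y. y \<in> Y \<Longrightarrow> r y \<noteq> v" by metis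
  have rV: "r y \<in> ?V" if "y \<in> Y" for y
  proof -
    have "{y, r y} \<in> E" using r(1)[OF that] by (auto simp: nb_def)
    then show ?thesis using edge indep[OF that] r(2)[OF that] by blast
  qed
  have WV: "?W \<subseteq> ?V"
  proof
    fix w assume "w \<in> ?W"
    then have "{v, w} \<in> E" "w \<notin> Y" by (auto simp: nb_def)
    then show "w \<in> ?V" using edge(2,3)[of v w] by simp
  qed
  have fc: "f' x \<in> set colours" if "x \<in> ?V" for x using f' that by (auto simp: twcol_def)
  \<comment> \<open>\<open>S\<close> collects the colours for \<open>v\<close> that suit the
    neighbour outside \<open>Y\<close>, all eight if there is none; \<open>F\<close> those that
    would block some vertex of \<open>Y\<close>.\<close>
  define S where "S = {c \<in> set colours. \<forall>w\<in>?W. twrel ((w, v) \<in> A) (f' w) c}"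
  define F where "F = (\<lambda>y. forb ((r y, y) \<in> A) ((v, y) \<in> A) (f' (r y))) ` Y"
  have "3 \<le> card S"
  proof (cases "?W = {}")
    case True
    then have "S = set colours" by (simp only: S_def) simp
    then show ?thesis by (simp add: colours_def)
  next
    case False
    then have "card ?W = 1"
      using one finite_nb[OF G] by (metis One_nat_def card_0_eq finite_Diff le_SucE le_zero_eq)
    then obtain w where w: "?W = {w}" by (metis card_1_singletonE)
    then have "w \<in> ?V" using WV by blast
    then show ?thesis using card_twrel[OF fc] by (simp add: S_def w)
  qed
  moreover have "card F \<le> 2" using card_image_le[OF finY] assms(6) unfolding F_def by (meson le_trans)
  moreover have "finite F" using finY by (simp add: F_def)
  ultimately have "\<not> S \<subseteq> F" using card_mono[of F S] by linarith
  then obtain c where c: "c \<in> S" "c \<notin> F" by blast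
  have cC: "c \<in> set colours" using c by (simp add: S_def)
  have "\<exists>k. k \<in> set colours \<and> twrel ((r y, y) \<in> A) (f' (r y)) k \<and> twrel ((v, y) \<in> A) c k" if "y \<in> Y" for y
    using twrel_two_path[OF fc[OF rV[OF that]] cC] c(2) that unfolding F_def by blast
  then obtain g where g: "\<And>y. y \<in> Y \<Longrightarrow> g y \<in> set colours \<and>
      twrel ((r y, y) \<in> A) (f' (r y)) (g y) \<and> twrel ((v, y) \<in> A) c (g y)" by metis
  define f where "f = (\<lambda>x. if x = v then c else if x \<in> Y then g x else f' x)"
  have fv: "f v = c" and fY: "\<And>y. y \<in> Y \<Longrightarrow> f y = g y" and fV: "\<And>x. x \<in> ?V \<Longrightarrow> f x = f' x"
    using vY by (auto simp: f_def)
  \<comment> \<open>Correctness at an edge in a form symmetric in its ends (\<open>sym\<close>), so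
    each kind of edge is checked in one order only.\<close>
  define P where "P = (\<lambda>a b. twrel ((a, b) \<in> A) (f a) (f b))"
  have sym: "P a b" if "{a, b} \<in> E" "P b a" for a b
    using anti[OF that(1)] that(2) by (auto simp: P_def twrel_def split: if_splits)
  have Pv: "P v y" and Pr: "P (r y) y" if "y \<in> Y" for y
    using g[OF that] fv fY[OF that] fV[OF rV[OF that]] by (simp_all add: P_def)
  have Pw: "P w v" if "w \<in> ?W" for w
  proof -
    have "w \<in> ?V" using WV that by blast
    then show ?thesis using c(1) that fv fV[of w] by (simp add: P_def S_def)
  qed
  have PV: "P a b" if "{a, b} \<in> E" "a \<in> ?V" "b \<in> ?V" for a b
  proof -
    have "twarc (f' x) (f' y)" if "(x, y) \<in> A" "x \<in> ?V" "y \<in> ?V" for x y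
      using f' that unfolding twcol_def by blast
    then show ?thesis
      using that(2,3) anti[OF that(1)] fV[OF that(2)] fV[OF that(3)] by (simp add: P_def twrel_def)
  qed
  have PY: "P a b" if "{a, b} \<in> E" "b \<in> Y" for a b
  proof -
    have "a \<in> nb E b" using that by (simp add: nb_def insert_commute)
    then show ?thesis using r(1)[OF that(2)] Pv[OF that(2)] Pr[OF that(2)] by auto
  qed
  have Pvb: "P a v" if "{a, v} \<in> E" "a \<notin> Y" for a
    using that Pw[of a] by (simp add: nb_def insert_commute)
  have all: "P a b" if e: "{a, b} \<in> E" for a b
  proof -
    have e': "{b, a} \<in> E" using e by (simp add: insert_commute)
    consider "b \<in> Y" | "a \<in> Y" | "b = v" "a \<notin> Y" | "a = v" "b \<notin> Y" | "a \<in> ?V" "b \<in> ?V"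
      using edge[OF e] by blast
    then show ?thesis
      using PY[OF e] PY[OF e'] Pvb[of a] Pvb[of b] PV[OF e] sym[OF e] e e' by cases auto
  qed
  have "twarc (f a) (f b)" if "(a, b) \<in> A" for a b
    using all[OF AE[OF that]] that by (simp add: P_def twrel_def)
  moreover have "f x \<in> set colours" if "x \<in> V" for x
    using that cC g fc[of x] by (auto simp: f_def)
  ultimately have "twcol V A f" by (auto simp: twcol_def)
  then show ?thesis by blast
qed

section \<open>Discharging\<close>

lemma handshake:
  assumes "simple_graph V E"
  shows "(\<Sum>v\<in>V. card (nb E v)) = 2 * card E"
proof -
  have fV: "finite V" using assms by (simp add: simple_graph_def)
  have E: "\<exists>u v. u \<noteq> v \<and> u \<in> V \<and> v \<in> V \<and> e = {u, v}" if "e \<in> E" for e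
    using assms that by (auto simp: simple_graph_def)
  have fE: "finite E" using fV E by (intro finite_subset[of E "Pow V"]) auto
  have "card (nb E v) = card {e \<in> E. v \<in> e}" for v
  proof (rule bij_betw_same_card[of "\<lambda>u. {v, u}"])
    show "bij_betw (\<lambda>u. {v, u}) (nb E v) {e \<in> E. v \<in> e}"
    proof (rule bij_betwI')
      fix e assume "e \<in> {e \<in> E. v \<in> e}"
      then show "\<exists>u\<in>nb E v. e = {v, u}" using E[of e] by (auto simp: nb_def insert_commute)
    qed (auto simp: nb_def doubleton_eq_iff)
  qed
  then have "(\<Sum>v\<in>V. card (nb E v)) = (\<Sum>v\<in>V. card {e \<in> E. v \<in> e})" by simp
  also have "\<dots> = (\<Sum>e\<in>E. card {v \<in> V. v \<in> e})"
    using sum.swap_restrict[OF fV fE, of "\<lambda>_ _. 1::nat" "\<lambda>v e. v \<in> e"] by simp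
  also have "\<dots> = (\<Sum>e\<in>E. 2)"
  proof (rule sum.cong)
    fix e assume "e \<in> E"
    then obtain u v where uv: "u \<noteq> v" "u \<in> V" "v \<in> V" "e = {u, v}" using E by blast
    then have "{w \<in> V. w \<in> e} = {u, v}" by auto
    then show "card {w \<in> V. w \<in> e} = 2" using uv by simp
  qed simp
  finally show ?thesis by simp
qed

text \<open>Discharging: each vertex of degree 2 receives 1/3 from each of its neighbours.\<close>
lemma sparse_has_reducible_vertex:
  assumes G: "simple_graph V E" and sparse: "3 * card E < 4 * card V"
  shows "\<exists>v\<in>V. \<exists>Y\<subseteq>nb E v. (\<forall>y\<in>Y. card (nb E y) = 2) \<and> card Y \<le> 2 \<and> card (nb E v - Y) \<le> 1"
proof (rule ccontr)
  assume no: "\<not> ?thesis"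
  define d where "d = (\<lambda>v. card (nb E v))"
  define T where "T = (\<lambda>v. {u \<in> nb E v. d u = 2})"
  define Two where "Two = {u \<in> V. d u = 2}"
  have fV: "finite V" using G by (simp add: simple_graph_def)
  note fin = finite_nb[OF G]
  have finT: "finite (T v)" for v using fin by (simp add: T_def)
  have TV: "T v = {u \<in> Two. v \<in> nb E u}" for v
    using simple_graph_edge[OF G] by (auto simp: T_def Two_def nb_def insert_commute)
  have nbV: "{v \<in> V. v \<in> nb E u} = nb E u" for u
    using simple_graph_edge[OF G] by (auto simp: nb_def)
  \<comment> \<open>With \<open>Y\<close> of size 0, 1, 2 this excludes degree at most 1, adjacent
    vertices of degree 2, and vertices of degree 3 with two neighbours of degree 2.\<close>
  have red: "\<not> (Y \<subseteq> T v \<and> card Y \<le> 2 \<and> d v \<le> 1 + card Y)" if v: "v \<in> V" for v Y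
  proof
    assume H: "Y \<subseteq> T v \<and> card Y \<le> 2 \<and> d v \<le> 1 + card Y"
    then have "Y \<subseteq> nb E v" "\<forall>y\<in>Y. card (nb E y) = 2" by (auto simp: T_def d_def)
    moreover from this have "card (nb E v - Y) \<le> 1"
      using H fin[of v] card_Diff_subset[of Y "nb E v"] finite_subset[of Y "nb E v"] by (auto simp: d_def)
    ultimately show False using no v H by blast
  qed
  \<comment> \<open>All charges are multiplied by 3: the final charge of every vertex is at least
    8.\<close>
  have charge: "8 + card (T v) \<le> 3 * d v + (if d v = 2 then 2 else 0)" if v: "v \<in> V" for v
  proof -
    have td: "card (T v) \<le> d v" unfolding d_def using fin by (intro card_mono) (auto simp: T_def)
    have pick: "\<exists>Y\<subseteq>T v. card Y = k" if "k \<le> card (T v)" for k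
      using that by (metis obtain_subset_with_card_n)
    have "\<not> d v \<le> 1" using red[OF v, of "{}"] by simp
    moreover have "card (T v) = 0" if "d v = 2"
    proof (rule ccontr)
      assume "card (T v) \<noteq> 0"
      then obtain Y where "Y \<subseteq> T v" "card Y = 1" using pick[of 1] by auto
      then show False using red[OF v, of Y] that by simp
    qed
    moreover have "card (T v) \<le> 1" if "d v = 3"
    proof (rule ccontr)
      assume "\<not> card (T v) \<le> 1"
      then obtain Y where "Y \<subseteq> T v" "card Y = 2" using pick[of 2] by auto
      then show False using red[OF v, of Y] that by simp
    qed
    ultimately consider "d v = 2" "card (T v) = 0" | "d v = 3" "card (T v) \<le> 1" | "d v \<ge> 4"
      by linarith
    then show ?thesis using td by cases auto
  qed
  have "(\<Sum>v\<in>V. card (T v)) = (\<Sum>u\<in>Two. card (nb E u))"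
    using sum.swap_restrict[OF fV, of Two "\<lambda>_ _. 1::nat" "\<lambda>v u. v \<in> nb E u"] fV
    by (simp add: TV nbV Two_def)
  also have "\<dots> = (\<Sum>u\<in>Two. 2)" by (rule sum.cong) (auto simp: Two_def d_def)
  finally have t: "(\<Sum>v\<in>V. card (T v)) = 2 * card Two" by simp
  have "(\<Sum>v\<in>V. 8 + card (T v)) \<le> (\<Sum>v\<in>V. 3 * d v + (if d v = 2 then 2 else 0))"
    by (intro sum_mono charge)
  moreover have "(\<Sum>v\<in>V. if d v = 2 then 2 else 0) = 2 * card Two"
    using fV by (simp add: Two_def sum.If_cases Int_def)
  moreover have "(\<Sum>v\<in>V. 3 * d v) = 6 * card E"
    using handshake[OF G] by (simp add: d_def flip: sum_distrib_left)
  ultimately have "8 * card V + 2 * card Two \<le> 6 * card E + 2 * card Two"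
    using t by (simp add: sum.distrib)
  then show False using sparse by linarith
qed

section \<open>Colouring planar graphs of girth at least eight\<close>

lemma planar_sparse:
  assumes "simple_graph V E" "planar V E" "girth_at_least V E 8" "V \<noteq> {}"
  shows "3 * card E < 4 * card V"
proof -
  obtain p and \<gamma> :: "'a set \<Rightarrow> real \<Rightarrow> complex" where "inj_on p V" and H: "\<forall>e\<in>E. arc (\<gamma> e) \<and>
           (\<exists>u v. e = {u, v} \<and> pathstart (\<gamma> e) = p u \<and> pathfinish (\<gamma> e) = p v) \<and>
           path_image (\<gamma> e) \<inter> p ` V \<subseteq> p ` e"
        "\<forall>e\<in>E. \<forall>e'\<in>E. e \<noteq> e' \<longrightarrow> path_image (\<gamma> e) \<inter> path_image (\<gamma> e') \<subseteq> p ` (e \<inter> e')"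
    using assms(2) unfolding planar_def by blast
  interpret plane_graph V E p \<gamma>
  proof
    show "simple_graph V E" by fact
    fix e assume e: "e \<in> E"
    show "arc (\<gamma> e)" "\<exists>u v. e = {u, v} \<and> pathstart (\<gamma> e) = p u \<and> pathfinish (\<gamma> e) = p v"
      "path_image (\<gamma> e) \<inter> p ` V \<subseteq> p ` e"
      using bspec[OF H(1) e] by simp_all
    fix e' assume "e' \<in> E" "e \<noteq> e'"
    then show "path_image (\<gamma> e) \<inter> path_image (\<gamma> e') \<subseteq> p ` (e \<inter> e')" using H(2) e by simp
  qed
  show ?thesis using edge_bound_girth_eight assms by blast
qed

lemma planar_subgraph:
  assumes "planar V E" "V' \<subseteq> V" "E' \<subseteq> E"
  shows "planar V' E'"
proof -
  obtain p and \<gamma> :: "'a set \<Rightarrow> real \<Rightarrow> complex" where "inj_on p V" and H: "\<forall>e\<in>E. arc (\<gamma> e) \<and>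
           (\<exists>u v. e = {u, v} \<and> pathstart (\<gamma> e) = p u \<and> pathfinish (\<gamma> e) = p v) \<and>
           path_image (\<gamma> e) \<inter> p ` V \<subseteq> p ` e"
        "\<forall>e\<in>E. \<forall>e'\<in>E. e \<noteq> e' \<longrightarrow> path_image (\<gamma> e) \<inter> path_image (\<gamma> e') \<subseteq> p ` (e \<inter> e')"
    using assms(1) unfolding planar_def by blast
  show ?thesis unfolding planar_def
  proof (intro exI[of _ p] exI[of _ \<gamma>] conjI ballI)
    show "inj_on p V'" using \<open>inj_on p V\<close> assms(2) inj_on_subset by blast
    fix e assume "e \<in> E'"
    then have e: "e \<in> E" using assms(3) by blast
    show "arc (\<gamma> e)" "\<exists>u v. e = {u, v} \<and> pathstart (\<gamma> e) = p u \<and> pathfinish (\<gamma> e) = p v"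
      using H(1) e by blast+
    show "path_image (\<gamma> e) \<inter> p ` V' \<subseteq> p ` e" using bspec[OF H(1) e] assms(2) by blast
    fix e' assume "e' \<in> E'"
    then show "e \<noteq> e' \<longrightarrow> path_image (\<gamma> e) \<inter> path_image (\<gamma> e') \<subseteq> p ` (e \<inter> e')"
      using H(2) e assms(3) by blast
  qed
qed

lemma girth_at_least_subgraph:
  assumes "girth_at_least V E g" "V' \<subseteq> V" "E' \<subseteq> E"
  shows "girth_at_least V' E' g"
  unfolding girth_at_least_def
proof (intro allI impI)
  fix cs assume "distinct cs \<and> 3 \<le> length cs \<and> set cs \<subseteq> V' \<and>
    (\<forall>i<length cs. {cs ! i, cs ! ((i + 1) mod length cs)} \<in> E')"
  then have "distinct cs \<and> 3 \<le> length cs \<and> set cs \<subseteq> V \<and>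
    (\<forall>i<length cs. {cs ! i, cs ! ((i + 1) mod length cs)} \<in> E)"
    using assms(2,3) by blast
  then show "g \<le> length cs" by (rule assms(1)[unfolded girth_at_least_def, rule_format])
qed

lemma girth_no_triangle:
  assumes "girth_at_least V E g" "g \<ge> 4" "simple_graph V E" "{a, b} \<in> E" "{b, c} \<in> E" "{c, a} \<in> E"
  shows False
proof -
  have ne: "a \<noteq> b" "b \<noteq> c" "c \<noteq> a" and V: "a \<in> V" "b \<in> V" "c \<in> V"
    using simple_graph_edge[OF assms(3)] assms(4-6) by blast+
  have "{[a, b, c] ! i, [a, b, c] ! ((i + 1) mod length [a, b, c])} \<in> E" if i: "i < length [a, b, c]" for i
  proof -
    consider "i = 0" | "i = 1" | "i = 2" using i by (auto simp: less_Suc_eq numeral_2_eq_2)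
    then show ?thesis using assms(4-6) by cases (auto simp: numeral_2_eq_2)
  qed
  then have "length [a, b, c] \<ge> g"
    using assms(1) ne V unfolding girth_at_least_def by (elim allE[of _ "[a, b, c]"]) auto
  then show False using assms(2) by simp
qed

lemma planar_girth_eight_twcol:
  assumes "simple_graph V E" "planar V E" "girth_at_least V E 8" "orientation_of E A"
  shows "\<exists>f. twcol V A f"
  using assms
proof (induction "card V" arbitrary: V E A rule: less_induct)
  case less
  note G = less.prems(1)
  have fV: "finite V" using G by (simp add: simple_graph_def)
  show ?case
  proof (cases "V = {}")
    case True
    then have "E = {}" using G by (auto simp: simple_graph_def)
    then have "A = {}" using less.prems(4) by (auto simp: orientation_of_def)
    then have "twcol V A f" for f using True by (simp add: twcol_def)
    then show ?thesis by blast
  next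
    case False
    obtain v Y where v: "v \<in> V" and Y: "Y \<subseteq> nb E v" "\<forall>y\<in>Y. card (nb E y) = 2" "card Y \<le> 2" "card (nb E v - Y) \<le> 1"
      using sparse_has_reducible_vertex[OF G planar_sparse[OF less.prems(1-3) False]] by blast
    let ?V = "V - insert v Y"
    let ?E = "{e \<in> E. e \<subseteq> ?V}" and ?A = "A \<inter> ?V \<times> ?V"
    have "simple_graph ?V ?E" using G by (fastforce simp: simple_graph_def)
    moreover have "planar ?V ?E" using planar_subgraph[OF less.prems(2), of ?V ?E] by auto
    moreover have "girth_at_least ?V ?E 8" using girth_at_least_subgraph[OF less.prems(3), of ?V ?E] by auto
    moreover have "orientation_of ?E ?A" using less.prems(4) unfolding orientation_of_def by blast
    moreover have "card ?V < card V" using fV v by (intro psubset_card_mono) auto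
    ultimately obtain f' where f': "twcol ?V ?A f'" using less.hyps by blast
    \<comment> \<open>Such an edge would form a triangle with \<open>v\<close>.\<close>
    have indep: "{y, y'} \<notin> E" if "y \<in> Y" "y' \<in> Y" for y y'
    proof
      assume "{y, y'} \<in> E"
      moreover have "{v, y} \<in> E" "{y', v} \<in> E"
        using that Y(1) by (auto simp: nb_def insert_commute[of _ v])
      ultimately show False using girth_no_triangle[OF less.prems(3) _ G, of v y y'] by simp
    qed
    show ?thesis using extend_colouring[OF G less.prems(4) v Y(1) _ Y(3,4) indep f'] Y(2) by blast
  qed
qed

text \<open>Pushing the vertices with sign \<open>True\<close> turns the arcs of the doubled
  tournament into arcs between first components.\<close>

lemma push_hom_if_twcol:
  assumes "twcol V A f" "A \<subseteq> V \<times> V"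
  shows "\<exists>(W :: nat set) B S f. finite W \<and> card W = 4 \<and> oriented_graph W B \<and> S \<subseteq> V \<and>
    oriented_hom V (push S A) W B f"
proof (intro exI conjI)
  let ?S = "{v \<in> V. snd (f v)}"
  show "finite {0, 1, 2, 3 :: nat}" "card {0, 1, 2, 3 :: nat} = 4" by auto
  show "oriented_graph {0, 1, 2, 3} (set beats)" by (auto simp: oriented_graph_def beats_def)
  show "?S \<subseteq> V" by auto
  have "fst ` set colours \<subseteq> {0, 1, 2, 3}" by (auto simp: colours_def)
  then have "(fst \<circ> f) ` V \<subseteq> {0, 1, 2, 3}" using assms(1) by (fastforce simp: twcol_def)
  moreover have "twarc (f u) (f v)" "u \<in> V" "v \<in> V" if "(u, v) \<in> A" for u v
    using assms that by (auto simp: twcol_def)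
  ultimately show "oriented_hom V (push ?S A) {0, 1, 2, 3} (set beats) (fst \<circ> f)"
    unfolding oriented_hom_def push_def twarc_def by (auto; metis)
qed

lemma push_chromatic_or_le_4:
  assumes "twcol V A f" "A \<subseteq> V \<times> V"
  shows "push_chromatic_or V A \<le> 4"
  unfolding push_chromatic_or_def using push_hom_if_twcol[OF assms] by (rule Least_le)

lemma orientation_exists:
  assumes "simple_graph V E"
  shows "\<exists>A. orientation_of E A"
proof -
  define t where "t = (\<lambda>e :: 'a set. SOME x. x \<in> e)"
  have t: "t {u, v} = u \<or> t {u, v} = v" for u v
    unfolding t_def using someI[of "\<lambda>x. x \<in> {u, v}" u] by blast
  have "orientation_of E {(u, v). {u, v} \<in> E \<and> t {u, v} = u}"
    unfolding orientation_of_def using t simple_graph_edge(3)[OF assms] by (auto simp: insert_commute)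
  then show ?thesis by blast
qed

lemma orientation_subset: "simple_graph V E \<Longrightarrow> orientation_of E A \<Longrightarrow> A \<subseteq> V \<times> V"
proof
  fix a assume "simple_graph V E" "orientation_of E A" "a \<in> A"
  moreover from this have "{fst a, snd a} \<in> E" by (auto simp: orientation_of_def)
  ultimately show "a \<in> V \<times> V" using simple_graph_edge(1,2)[of V E "fst a" "snd a"] by (simp add: mem_Times_iff)
qed

text \<open>Finiteness is stated too because \<open>push_chromatic\<close> is a \<open>Max\<close>,
  and the lower bound will need \<open>Max_ge\<close> on the same set.\<close>

lemma push_chromatic_planar_girth_eight:
  assumes "simple_graph V E" "planar V E" "girth_at_least V E 8"
  defines "X \<equiv> {push_chromatic_or V A | A. orientation_of E A}"
  shows "finite X" "push_chromatic V E \<le> 4"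
proof -
  have X: "X \<subseteq> {..4}"
    using planar_girth_eight_twcol[OF assms(1-3)] push_chromatic_or_le_4 orientation_subset[OF assms(1)]
    unfolding X_def by blast
  then show fin: "finite X" using finite_subset by blast
  have "X \<noteq> {}" using orientation_exists[OF assms(1)] by (auto simp: X_def)
  then show "push_chromatic V E \<le> 4"
    unfolding push_chromatic_def X_def[symmetric] using fin X by (auto simp: Max_le_iff)
qed

section \<open>The lower bound\<close>

text \<open>Twice the signed area of the triangle \<open>P Q z\<close>; its sign tells the side of
  the line \<open>P Q\<close> on which \<open>z\<close> lies.\<close>

definition cross :: "complex \<Rightarrow> complex \<Rightarrow> complex \<Rightarrow> real" where
  "cross P Q z = (Re Q - Re P) * (Im z - Im P) - (Im Q - Im P) * (Re z - Re P)"

lemma cross_affine: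
  assumes "z \<in> closed_segment R S"
  obtains t where "0 \<le> t" "t \<le> 1" "z = (1 - t) *\<^sub>R R + t *\<^sub>R S"
    "cross P Q z = (1 - t) * cross P Q R + t * cross P Q S"
proof -
  obtain t where t: "0 \<le> t" "t \<le> 1" "z = (1 - t) *\<^sub>R R + t *\<^sub>R S"
    using assms by (auto simp: closed_segment_def)
  have "cross P Q z = (1 - t) * cross P Q R + t * cross P Q S"
    unfolding t(3) by (simp add: cross_def algebra_simps)
  then show ?thesis using that t by blast
qed

lemma cross_on_line: "z \<in> closed_segment P Q \<Longrightarrow> cross P Q z = 0"
  by (erule cross_affine[of z P Q P Q]) (simp add: cross_def)

lemma segments_disjoint:
  assumes "cross P Q R * cross P Q S > 0"
  shows "closed_segment P Q \<inter> closed_segment R S = {}"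
proof (rule ccontr)
  assume "\<not> ?thesis"
  then obtain z where z: "z \<in> closed_segment P Q" "z \<in> closed_segment R S" by blast
  obtain t where t: "0 \<le> t" "t \<le> 1" "(1 - t) * cross P Q R + t * cross P Q S = 0"
    using cross_affine[OF z(2), of P Q] cross_on_line[OF z(1)] by metis
  consider "cross P Q R > 0" "cross P Q S > 0" | "cross P Q R < 0" "cross P Q S < 0"
    using assms by (auto simp: zero_less_mult_iff)
  then show False
  proof cases
    case 1
    then have "(1 - t) * cross P Q R \<ge> 0" "t * cross P Q S \<ge> 0" using t by simp_all
    then have "(1 - t) * cross P Q R = 0" "t * cross P Q S = 0" using t(3) by linarith+
    then show False using 1 by auto
  next
    case 2
    then have "(1 - t) * cross P Q R \<le> 0" "t * cross P Q S \<le> 0"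
      using t by (simp_all add: mult_nonneg_nonpos)
    then have "(1 - t) * cross P Q R = 0" "t * cross P Q S = 0" using t(3) by linarith+
    then show False using 2 by auto
  qed
qed

lemma segments_meet_in_endpoint:
  assumes "cross P Q S \<noteq> 0"
  shows "closed_segment P Q \<inter> closed_segment P S \<subseteq> {P}"
proof
  fix z assume "z \<in> closed_segment P Q \<inter> closed_segment P S"
  then have z: "z \<in> closed_segment P Q" "z \<in> closed_segment P S" by auto
  obtain t where t: "z = (1 - t) *\<^sub>R P + t *\<^sub>R S" "(1 - t) * cross P Q P + t * cross P Q S = 0"
    using cross_affine[OF z(2), of P Q] cross_on_line[OF z(1)] by metis
  then have "t = 0" using assms by (simp add: cross_def)
  then show "z \<in> {P}" using t by simp
qed

definition icross :: "int \<times> int \<Rightarrow> int \<times> int \<Rightarrow> int \<times> int \<Rightarrow> int" where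
  "icross p q z = (fst q - fst p) * (snd z - snd p) - (snd q - snd p) * (fst z - fst p)"

text \<open>A sufficient certificate decidable in integer arithmetic: edges with a common end are
  not collinear, and of two others one lies strictly on one side of the line through the
  other.\<close>

definition noncrossing :: "('a \<Rightarrow> int \<times> int) \<Rightarrow> 'a \<times> 'a \<Rightarrow> 'a \<times> 'a \<Rightarrow> bool" where
  "noncrossing q e e' = (case (e, e') of ((a, b), (c, d)) \<Rightarrow>
     if a = c then icross (q a) (q b) (q d) \<noteq> 0
     else if a = d then icross (q a) (q b) (q c) \<noteq> 0
     else if b = c then icross (q b) (q a) (q d) \<noteq> 0
     else if b = d then icross (q b) (q a) (q c) \<noteq> 0
     else icross (q a) (q b) (q c) * icross (q a) (q b) (q d) > 0 \<or>
          icross (q c) (q d) (q a) * icross (q c) (q d) (q b) > 0)"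

text \<open>The assumption \<open>cover\<close> reduces everything to pairs of edges: a vertex on a
  foreign edge would be a point shared with one of its own edges.\<close>

lemma straight_line_planar:
  fixes q :: "'a \<Rightarrow> int \<times> int"
  assumes inj: "inj_on q V" and E: "E = (\<lambda>(u, v). {u, v}) ` set es"
    and ends: "\<And>u v. (u, v) \<in> set es \<Longrightarrow> u \<in> V \<and> v \<in> V \<and> u \<noteq> v"
    and cover: "\<And>w. w \<in> V \<Longrightarrow> \<exists>e\<in>E. w \<in> e"
    and nc: "sorted_wrt (noncrossing q) es"
  shows "planar V E"
proof -
  define p where "p v = Complex (of_int (fst (q v))) (of_int (snd (q v)))" for v
  have cross_p: "cross (p a) (p b) (p c) = of_int (icross (q a) (q b) (q c))" for a b c
    by (simp add: cross_def icross_def p_def)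
  have injp: "inj_on p V"
    using inj by (auto simp: inj_on_def p_def prod_eq_iff)
  have cross_pos: "cross (p a) (p b) (p c) * cross (p a) (p b) (p d) > 0"
    if "icross (q a) (q b) (q c) * icross (q a) (q b) (q d) > 0" for a b c d
    using that unfolding cross_p by (simp flip: of_int_mult)
  define seg where "seg = (\<lambda>(u, v). closed_segment (p u) (p v))"
  define st where "st = (\<lambda>(u, v). {u, v} :: 'a set)"
  have seg_Int: "seg e \<inter> seg e' \<subseteq> p ` (st e \<inter> st e')" if "noncrossing q e e'" for e e'
  proof -
    obtain a b c d where e: "e = (a, b)" "e' = (c, d)" by (cases e; cases e') blast
    let ?s = "\<lambda>a b. closed_segment (p a) (p b)"
    have sym: "?s a b = ?s b a" for a b by (rule closed_segment_commute)
    have meet: "?s x y \<inter> ?s x z \<subseteq> p ` {x}" if "icross (q x) (q y) (q z) \<noteq> 0" for x y z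
      using segments_meet_in_endpoint[of "p x" "p y" "p z"] that by (simp add: cross_p)
    have disj: "?s x y \<inter> ?s z w = {}" if "icross (q x) (q y) (q z) * icross (q x) (q y) (q w) > 0" for x y z w
      using segments_disjoint[OF cross_pos[OF that]] .
    have "?s a b \<inter> ?s c d \<subseteq> p ` ({a, b} \<inter> {c, d})"
    proof -
      consider "a = c" "icross (q a) (q b) (q d) \<noteq> 0" | "a = d" "icross (q a) (q b) (q c) \<noteq> 0"
        | "b = c" "icross (q b) (q a) (q d) \<noteq> 0" | "b = d" "icross (q b) (q a) (q c) \<noteq> 0"
        | "icross (q a) (q b) (q c) * icross (q a) (q b) (q d) > 0"
        | "icross (q c) (q d) (q a) * icross (q c) (q d) (q b) > 0"
        using \<open>noncrossing q e e'\<close> by (auto simp: noncrossing_def e split: if_splits)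
      then show ?thesis
      proof cases
        case 1 then show ?thesis using meet[of a b d] by auto
      next
        case 2
        have "?s c d = ?s a c" "?s a b = ?s a b" using 2(1) sym by metis+
        then show ?thesis using meet[of a b c, OF 2(2)] 2(1) by (simp only:) blast
      next
        case 3
        have "?s c d = ?s b d" "?s a b = ?s b a" using 3(1) sym by metis+
        then show ?thesis using meet[of b a d, OF 3(2)] 3(1) by (simp only:) blast
      next
        case 4
        have "?s c d = ?s b c" "?s a b = ?s b a" using 4(1) sym by metis+
        then show ?thesis using meet[of b a c, OF 4(2)] 4(1) by (simp only:) blast
      next
        case 5 then show ?thesis using disj[of a b c d] by simp
      next
        case 6 then show ?thesis using disj[of c d a b] by auto
      qed
    qed
    then show ?thesis by (simp add: e seg_def st_def)
  qed
  \<comment> \<open>Arcs are indexed by unordered edges; the listed pair supplies the direction of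
    parametrisation.\<close>
  define rep where "rep e = (SOME x. x \<in> set es \<and> st x = e)" for e
  have rep: "rep e \<in> set es \<and> st (rep e) = e" if "e \<in> E" for e
    unfolding rep_def
  proof (rule someI_ex)
    show "\<exists>x. x \<in> set es \<and> st x = e" using that by (auto simp: E st_def)
  qed
  define \<gamma> where "\<gamma> e = linepath (p (fst (rep e))) (p (snd (rep e)))" for e
  have im: "path_image (\<gamma> e) = seg (rep e)" for e
    by (simp add: \<gamma>_def seg_def case_prod_beta)
  have Int: "path_image (\<gamma> e) \<inter> path_image (\<gamma> e') \<subseteq> p ` (e \<inter> e')" if ee: "e \<in> E" "e' \<in> E" "e \<noteq> e'" for e e'
  proof -
    have r: "rep e \<in> set es" "rep e' \<in> set es" "st (rep e) = e" "st (rep e') = e'"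
      using rep ee by auto
    then have "rep e \<noteq> rep e'" using ee(3) by metis
    moreover obtain i where i: "i < length es" "es ! i = rep e" using r(1) by (metis in_set_conv_nth)
    moreover obtain j where j: "j < length es" "es ! j = rep e'" using r(2) by (metis in_set_conv_nth)
    ultimately consider "i < j" | "j < i" by (metis nat_neq_iff)
    then have "noncrossing q (rep e) (rep e') \<or> noncrossing q (rep e') (rep e)"
      using nc i j unfolding sorted_wrt_iff_nth_less by cases metis+
    then have "seg (rep e) \<inter> seg (rep e') \<subseteq> p ` (st (rep e) \<inter> st (rep e'))"
      using seg_Int[of "rep e" "rep e'"] seg_Int[of "rep e'" "rep e"] by (auto simp: Int_commute)
    then show ?thesis by (simp add: im r(3,4))
  qed
  have ends_in: "p w \<in> path_image (\<gamma> e)" if "e \<in> E" "w \<in> e" for e w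
    using rep[OF that(1)] that(2) by (auto simp: im seg_def st_def split: prod.splits)
  show ?thesis unfolding planar_def
  proof (intro exI[of _ p] exI[of _ \<gamma>] conjI ballI impI)
    show "inj_on p V" by (rule injp)
    fix e assume e: "e \<in> E"
    obtain u v where uv: "rep e = (u, v)" by (cases "rep e")
    then have r: "(u, v) \<in> set es" "e = {u, v}" using rep[OF e] by (auto simp: st_def)
    have "p u \<noteq> p v" using ends[OF r(1)] injp by (auto dest: inj_onD)
    then show "arc (\<gamma> e)" by (simp add: \<gamma>_def uv arc_linepath)
    show "\<exists>u v. e = {u, v} \<and> pathstart (\<gamma> e) = p u \<and> pathfinish (\<gamma> e) = p v"
      using r(2) uv by (auto simp: \<gamma>_def)
    show "path_image (\<gamma> e) \<inter> p ` V \<subseteq> p ` e"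
    proof
      fix z assume "z \<in> path_image (\<gamma> e) \<inter> p ` V"
      then obtain w where w: "w \<in> V" "z = p w" "z \<in> path_image (\<gamma> e)" by blast
      obtain e' where e': "e' \<in> E" "w \<in> e'" using cover[OF w(1)] by blast
      show "z \<in> p ` e"
      proof (cases "e' = e")
        case False
        then have "z \<in> p ` (e \<inter> e')" using Int[OF e e'(1)] ends_in[OF e'] w by blast
        then show ?thesis by blast
      qed (use e' w in blast)
    qed
    fix e' assume "e' \<in> E" "e \<noteq> e'"
    then show "path_image (\<gamma> e) \<inter> path_image (\<gamma> e') \<subseteq> p ` (e \<inter> e')" using Int[OF e] by blast
  qed
qed

section \<open>Girth by exhaustive search\<close>

text \<open>Bounded search for a walk from \<open>cur\<close> back to \<open>s\<close> that never
  reverses its last step; \<open>prev\<close> is the vertex just left.\<close>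

fun no_return :: "('a \<Rightarrow> 'a list) \<Rightarrow> 'a \<Rightarrow> nat \<Rightarrow> 'a \<Rightarrow> 'a \<Rightarrow> bool" where
  "no_return adj s 0 prev cur = True"
| "no_return adj s (Suc k) prev cur =
     (\<forall>n\<in>set (adj cur). n = prev \<or> (n \<noteq> s \<and> no_return adj s k cur n))"

text \<open>A cycle is a non-backtracking closed walk. One step to \<open>n\<close> and
  \<open>g\<close> further ones cover all cycles of length at most \<open>g + 1\<close>.\<close>

lemma girth_at_least_by_search:
  assumes adj: "\<And>u v. {u, v} \<in> E \<Longrightarrow> v \<in> set (adj u)"
    and search: "\<And>s n. s \<in> V \<Longrightarrow> n \<in> set (adj s) \<Longrightarrow> no_return adj s g s n"
  shows "girth_at_least V E (g + 2)"
  unfolding girth_at_least_def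
proof (intro allI impI)
  fix cs assume H: "distinct cs \<and> 3 \<le> length cs \<and> set cs \<subseteq> V \<and>
    (\<forall>i<length cs. {cs ! i, cs ! ((i + 1) mod length cs)} \<in> E)"
  let ?L = "length cs"
  have d: "distinct cs" and L: "3 \<le> ?L" and V: "set cs \<subseteq> V"
    and e: "\<And>i. i < ?L \<Longrightarrow> {cs ! i, cs ! ((i + 1) mod ?L)} \<in> E" using H by auto
  have step: "cs ! Suc i \<in> set (adj (cs ! i))" if "Suc i < ?L" for i
    using adj[OF e[of i]] that by simp
  show "g + 2 \<le> ?L"
  proof (rule ccontr)
    assume "\<not> g + 2 \<le> ?L"
    then have Lg: "?L \<le> Suc g" by simp
    have walk: "no_return adj (cs ! 0) (g - i) (cs ! i) (cs ! Suc i)" if "Suc i < ?L" for i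
      using that
    proof (induction i)
      case 0
      then show ?case using search[of "cs ! 0" "cs ! Suc 0"] step[of 0] V nth_mem[of 0 cs] by (metis Suc_lessD diff_zero subsetD)
    next
      case (Suc i)
      have "g - i = Suc (g - Suc i)" using Suc.prems Lg by simp
      then have "\<forall>n\<in>set (adj (cs ! Suc i)). n = cs ! i \<or> (n \<noteq> cs ! 0 \<and> no_return adj (cs ! 0) (g - Suc i) (cs ! Suc i) n)"
        using Suc by (metis Suc_lessD no_return.simps(2))
      moreover have "cs ! Suc (Suc i) \<noteq> cs ! i" using d Suc.prems by (simp add: nth_eq_iff_index_eq)
      ultimately show ?case using step[OF Suc.prems] by blast
    qed
    define m where "m = ?L - 2"
    have m: "?L = Suc (Suc m)" "m \<ge> 1" using L by (simp_all add: m_def)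
    have gm: "g - m = Suc (g - Suc m)" using m Lg by simp
    have "cs ! 0 \<in> set (adj (cs ! Suc m))" using adj[OF e[of "Suc m"]] m by simp
    moreover have "cs ! 0 \<noteq> cs ! m" using d m nth_eq_iff_index_eq[OF d, of 0 m] by simp
    ultimately show False using walk[of m] m unfolding gm by auto
  qed
qed

section \<open>Targets with three vertices\<close>

text \<open>Adjacency in the circulant graph modulo 6 with connection set 1, 2, in which adding 3
  realises a push.\<close>
definition hex_step :: "int \<Rightarrow> int \<Rightarrow> bool" where
  "hex_step a b \<longleftrightarrow> (b - a) mod 6 = 1 \<or> (b - a) mod 6 = 2"

text \<open>The circulant contains both tournaments on three vertices: 0, 1, 2 is transitive and 0,
  2, 4 is cyclic.\<close>

lemma small_oriented_graph_hex:
  assumes "oriented_graph W B" "finite W" "card W \<le> 3"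
  shows "\<exists>h. \<forall>(x, y)\<in>B. hex_step (h x) (h y)"
proof -
  have anti: "(x, y) \<in> B \<Longrightarrow> x \<noteq> y \<and> (y, x) \<notin> B \<and> x \<in> W \<and> y \<in> W" for x y
    using assms(1) by (auto simp: oriented_graph_def)
  obtain xs where xs: "set xs = W" "length xs \<le> 3"
    using finite_distinct_list[OF assms(2)] assms(3) by (metis distinct_card)
  \<comment> \<open>If \<open>W\<close> has fewer than three elements, the entries past the end are
    unspecified; only the inclusion \<open>W\<close> is claimed, and coinciding values are resolved
    by the order of cases in \<open>h\<close>.\<close>
  define a b c where "a = xs ! 0" "b = xs ! 1" "c = xs ! 2"
  have W: "W \<subseteq> {a, b, c}"
  proof
    fix x assume "x \<in> W"
    then obtain i where i: "i < length xs" "x = xs ! i" using xs(1) by (metis in_set_conv_nth)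
    then have "i = 0 \<or> i = 1 \<or> i = 2" using xs(2) by linarith
    then show "x \<in> {a, b, c}" using i(2) unfolding a_b_c_def by blast
  qed
  \<comment> \<open>With \<open>a\<close> at 0, the eight tournaments are tabulated; a missing arc
    is read as the reverse one.\<close>
  define \<beta> \<gamma> :: int where "\<beta> = (if (a, b) \<in> B then if (a, c) \<in> B \<longleftrightarrow> (b, c) \<in> B then 1 else 2
      else if (a, c) \<in> B \<longleftrightarrow> (b, c) \<in> B then 5 else 4)"
    and "\<gamma> = (if (a, b) \<in> B then if (a, c) \<in> B then if (b, c) \<in> B then 2 else 1 else if (b, c) \<in> B then 4 else 5
      else if (a, c) \<in> B then if (b, c) \<in> B then 1 else 2 else if (b, c) \<in> B then 5 else 4)"
  have step: "(a, b) \<in> B \<Longrightarrow> hex_step 0 \<beta>" "(b, a) \<in> B \<Longrightarrow> hex_step \<beta> 0"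
    "(a, c) \<in> B \<Longrightarrow> hex_step 0 \<gamma>" "(c, a) \<in> B \<Longrightarrow> hex_step \<gamma> 0"
    "(b, c) \<in> B \<Longrightarrow> hex_step \<beta> \<gamma>" "(c, b) \<in> B \<Longrightarrow> hex_step \<gamma> \<beta>"
    using anti[of a b] anti[of b a] anti[of a c] anti[of c a] anti[of b c] anti[of c b]
    by (simp_all add: \<beta>_def \<gamma>_def hex_step_def)
  define h where "h = (\<lambda>x. if x = a then 0 else if x = b then \<beta> else \<gamma>)"
  have h: "h a = 0" "b \<noteq> a \<Longrightarrow> h b = \<beta>" "c \<noteq> a \<Longrightarrow> c \<noteq> b \<Longrightarrow> h c = \<gamma>" by (simp_all add: h_def)
  have "hex_step (h x) (h y)" if xy: "(x, y) \<in> B" for x y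
  proof -
    have n: "x \<noteq> y" using anti[OF xy] by simp
    have "x = a \<or> x = b \<and> x \<noteq> a \<or> x = c \<and> x \<noteq> a \<and> x \<noteq> b" "y = a \<or> y = b \<and> y \<noteq> a \<or> y = c \<and> y \<noteq> a \<and> y \<noteq> b"
      using anti[OF xy] W by blast+
    then show ?thesis using xy n step h by (elim disjE conjE) simp_all
  qed
  then show ?thesis by blast
qed

lemma push_hom_hex:
  assumes "oriented_graph W B" "finite W" "card W \<le> 3" "oriented_hom V (push S A) W B f"
  shows "\<exists>c. \<forall>(u, v)\<in>A. hex_step (c u) (c v)"
proof -
  obtain h where h: "\<And>x y. (x, y) \<in> B \<Longrightarrow> hex_step (h x) (h y)"
    using small_oriented_graph_hex[OF assms(1-3)] by blast
  define c where "c v = h (f v) + (if v \<in> S then 3 else 0)" for v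
  have f: "hex_step (h (f u)) (h (f v))" if "(u, v) \<in> push S A" for u v
    using assms(4) that h by (auto simp: oriented_hom_def)
  have "hex_step (c u) (c v)" if "(u, v) \<in> A" for u v
  proof (cases "u \<in> S \<longleftrightarrow> v \<in> S")
    case True
    then have "hex_step (h (f u)) (h (f v))" using that by (intro f) (auto simp: push_def)
    then show ?thesis using True by (simp add: c_def hex_step_def)
  next
    case False
    then have "hex_step (h (f v)) (h (f u))" using that by (intro f) (auto simp: push_def)
    then have "hex_step (h (f u)) (h (f v) + 3)" "hex_step (h (f u) + 3) (h (f v))"
      unfolding hex_step_def by presburger+
    then show ?thesis using False by (auto simp: c_def)
  qed
  then show ?thesis by blast
qed

text \<open>The four forward steps add up to 4..8, the three forward and one backward to 1..5, both
  modulo 6. The only multiples of 3 there are 6 and 3, which disagree modulo 6.\<close>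

lemma unbalanced_octagon:
  assumes "hex_step u x" "hex_step x y" "hex_step y z" "hex_step z v"
    and "hex_step u x'" "hex_step x' y'" "hex_step y' z'" "hex_step v z'"
  shows "(v - u) mod 3 \<noteq> 0"
proof -
  have r: "\<exists>k r. b - a = 6 * k + r \<and> 1 \<le> r \<and> r \<le> 2" if "hex_step a b" for a b
    using that unfolding hex_step_def
    by (intro exI[of _ "(b - a) div 6"] exI[of _ "(b - a) mod 6"]) auto
  obtain k1 r1 where 1: "x - u = 6 * k1 + r1" "1 \<le> r1" "r1 \<le> 2" using r[OF assms(1)] by blast
  obtain k2 r2 where 2: "y - x = 6 * k2 + r2" "1 \<le> r2" "r2 \<le> 2" using r[OF assms(2)] by blast
  obtain k3 r3 where 3: "z - y = 6 * k3 + r3" "1 \<le> r3" "r3 \<le> 2" using r[OF assms(3)] by blast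
  obtain k4 r4 where 4: "v - z = 6 * k4 + r4" "1 \<le> r4" "r4 \<le> 2" using r[OF assms(4)] by blast
  obtain l1 s1 where 5: "x' - u = 6 * l1 + s1" "1 \<le> s1" "s1 \<le> 2" using r[OF assms(5)] by blast
  obtain l2 s2 where 6: "y' - x' = 6 * l2 + s2" "1 \<le> s2" "s2 \<le> 2" using r[OF assms(6)] by blast
  obtain l3 s3 where 7: "z' - y' = 6 * l3 + s3" "1 \<le> s3" "s3 \<le> 2" using r[OF assms(7)] by blast
  obtain l4 s4 where 8: "z' - v = 6 * l4 + s4" "1 \<le> s4" "s4 \<le> 2" using r[OF assms(8)] by blast
  have a: "v - u = 6 * (k1 + k2 + k3 + k4) + (r1 + r2 + r3 + r4)" 
    using 1(1) 2(1) 3(1) 4(1) by (simp add: algebra_simps)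
  have b: "v - u = 6 * (l1 + l2 + l3 - l4) + (s1 + s2 + s3 - s4)" 
    using 5(1) 6(1) 7(1) 8(1) by (simp add: algebra_simps)
  define R K S L where "R = r1 + r2 + r3 + r4" "K = k1 + k2 + k3 + k4" "S = s1 + s2 + s3 - s4" "L = l1 + l2 + l3 - l4"
  have R: "4 \<le> R" "R \<le> 8" and S: "1 \<le> S" "S \<le> 5"
    using 1 2 3 4 5 6 7 8 by (simp_all add: R_K_S_L_def)
  have K: "v - u = 6 * K + R" and L: "v - u = 6 * L + S" using a b by (simp_all add: R_K_S_L_def)
  show ?thesis
  proof
    assume "(v - u) mod 3 = 0"
    then have "R mod 3 = 0" "S mod 3 = 0" using K L by presburger+
    then have "R = 6" "S = 3" using R S by presburger+
    then show False using K L by presburger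
  qed
qed

text \<open>The complete graph on 0, 1, 2, 3 with the edges 02, 03, 12, 13 replaced by 8-cycles having an odd
  number of forward arcs.\<close>
definition octa_arcs :: "(nat \<times> nat) list" where
  "octa_arcs = [(0, 1), (2, 3),
     (0, 4), (4, 5), (5, 6), (6, 2), (0, 7), (7, 8), (8, 9), (2, 9),
     (0, 10), (10, 11), (11, 12), (12, 3), (0, 13), (13, 14), (14, 15), (3, 15),
     (1, 16), (16, 17), (17, 18), (18, 2), (1, 19), (19, 20), (20, 21), (2, 21),
     (1, 22), (22, 23), (23, 24), (24, 3), (1, 25), (25, 26), (26, 27), (3, 27)]"

text \<open>Written out so that the search can be executed; that no edge is missing is checked in
  \<open>octa_adj_arcs\<close>.\<close>

definition octa_adj :: "nat \<Rightarrow> nat list" where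
  "octa_adj v = [[1, 4, 7, 10, 13], [0, 16, 19, 22, 25], [3, 6, 9, 18, 21], [2, 12, 15, 24, 27],
     [0, 5], [4, 6], [5, 2], [0, 8], [7, 9], [8, 2], [0, 11], [10, 12], [11, 3], [0, 14], [13, 15],
     [14, 3], [1, 17], [16, 18], [17, 2], [1, 20], [19, 21], [20, 2], [1, 23], [22, 24], [23, 3],
     [1, 26], [25, 27], [26, 3]] ! v"

text \<open>The usual drawing of the complete graph with 1 inside the triangle 0, 2, 3, each
  replaced edge opened into a thin octagon.\<close>

definition octa_pos :: "nat \<Rightarrow> int \<times> int" where
  "octa_pos v = [(0, 30), (0, 4), (-24, -12), (24, -12), (-4, 19), (-9, 8), (-16, -2), (-8, 20),
     (-15, 10), (-20, -1), (8, 20), (15, 10), (20, -1), (4, 19), (9, 8), (16, -2), (-5, -2), (-10, -6),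
     (-17, -10), (-7, 2), (-14, -2), (-19, -6), (7, 2), (14, -2), (19, -6), (5, -2), (10, -6), (17, -10)] ! v"

lemma octa_noncrossing: "sorted_wrt (noncrossing octa_pos) octa_arcs"
  by (simp add: octa_arcs_def noncrossing_def octa_pos_def icross_def)

lemma octa_adj_arcs: "\<forall>(u, v)\<in>set octa_arcs. v \<in> set (octa_adj u) \<and> u \<in> set (octa_adj v)"
  by code_simp

lemma octa_search: "\<forall>s\<in>set [0..<28]. \<forall>n\<in>set (octa_adj s). no_return octa_adj s 6 s n"
  by code_simp

lemma octa_pos_distinct: "distinct (map octa_pos [0..<28])"
  by code_simp

lemma octa_oriented: "\<forall>(u, v)\<in>set octa_arcs. u < 28 \<and> v < 28 \<and> u \<noteq> v \<and> (v, u) \<notin> set octa_arcs"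
  by code_simp

lemma octa_cover: "\<forall>w\<in>set [0..<28]. \<exists>e\<in>set octa_arcs. w = fst e \<or> w = snd e"
  by code_simp

definition octa_edges :: "nat set set" where
  "octa_edges = (\<lambda>(u, v). {u, v}) ` set octa_arcs"

lemma octa_edge_iff: "{u, v} \<in> octa_edges \<longleftrightarrow> (u, v) \<in> set octa_arcs \<or> (v, u) \<in> set octa_arcs"
  by (force simp: octa_edges_def doubleton_eq_iff)

lemma octa_simple: "simple_graph {..<28} octa_edges"
  using octa_oriented unfolding simple_graph_def octa_edges_def by fastforce

lemma octa_orientation: "orientation_of octa_edges (set octa_arcs)"
  unfolding orientation_of_def octa_edge_iff using octa_oriented by blast

lemma octa_planar: "planar {..<28} octa_edges"
proof (rule straight_line_planar[OF _ octa_edges_def _ _ octa_noncrossing])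
  show "inj_on octa_pos {..<28}"
    using octa_pos_distinct by (simp only: distinct_map set_upt atLeast0LessThan)
  show "u \<in> {..<28} \<and> v \<in> {..<28} \<and> u \<noteq> v" if "(u, v) \<in> set octa_arcs" for u v
    using octa_oriented that by blast
  show "\<exists>e\<in>octa_edges. w \<in> e" if "w \<in> {..<28}" for w
  proof -
    have "w \<in> set [0..<28]" using that by simp
    then obtain e where e: "e \<in> set octa_arcs" "w = fst e \<or> w = snd e" using octa_cover by blast
    then have "{fst e, snd e} \<in> octa_edges" by (simp add: octa_edge_iff)
    then show ?thesis using e(2) by blast
  qed
qed

lemma octa_girth: "girth_at_least {..<28} octa_edges 8"
proof -
  have "girth_at_least {..<28} octa_edges (6 + 2)"
  proof (rule girth_at_least_by_search)
    show "v \<in> set (octa_adj u)" if "{u, v} \<in> octa_edges" for u v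
      using that octa_adj_arcs unfolding octa_edge_iff by blast
    show "no_return octa_adj s 6 s n" if "s \<in> {..<28}" "n \<in> set (octa_adj s)" for s n
    proof -
      have "s \<in> set [0..<28]" using that(1) by simp
      then show ?thesis using octa_search that(2) by blast
    qed
  qed
  then show ?thesis by simp
qed

text \<open>Pigeonhole: the two remaining edges and the four octagons make the values at 0, 1, 2, 3
  pairwise different modulo 3.\<close>

lemma octa_not_hex: "\<not> (\<forall>(u, v)\<in>set octa_arcs. hex_step (c u) (c v))"
proof
  assume "\<forall>(u, v)\<in>set octa_arcs. hex_step (c u) (c v)"
  then have s: "hex_step (c u) (c v)" if "(u, v) \<in> set octa_arcs" for u v using that by blast
  have edge: "(b - a) mod 3 \<noteq> 0" if "hex_step a b" for a b
    using that unfolding hex_step_def by presburger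
  have "(c 1 - c 0) mod 3 \<noteq> 0" "(c 3 - c 2) mod 3 \<noteq> 0"
    by (rule edge, rule s, simp add: octa_arcs_def)+
  moreover have "(c 2 - c 0) mod 3 \<noteq> 0"
    by (rule unbalanced_octagon[of "c 0" "c 4" "c 5" "c 6" "c 2" "c 7" "c 8" "c 9"];
        rule s, simp add: octa_arcs_def)
  moreover have "(c 3 - c 0) mod 3 \<noteq> 0"
    by (rule unbalanced_octagon[of "c 0" "c 10" "c 11" "c 12" "c 3" "c 13" "c 14" "c 15"];
        rule s, simp add: octa_arcs_def)
  moreover have "(c 2 - c 1) mod 3 \<noteq> 0"
    by (rule unbalanced_octagon[of "c 1" "c 16" "c 17" "c 18" "c 2" "c 19" "c 20" "c 21"];
        rule s, simp add: octa_arcs_def)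
  moreover have "(c 3 - c 1) mod 3 \<noteq> 0"
    by (rule unbalanced_octagon[of "c 1" "c 22" "c 23" "c 24" "c 3" "c 25" "c 26" "c 27"];
        rule s, simp add: octa_arcs_def)
  moreover have "x mod 3 \<noteq> y mod 3" if "(y - x) mod 3 \<noteq> 0" for x y :: int
    using that by (metis cancel_comm_monoid_add_class.diff_cancel mod_0 mod_diff_eq)
  ultimately have d: "c 0 mod 3 \<noteq> c 1 mod 3" "c 2 mod 3 \<noteq> c 3 mod 3" "c 0 mod 3 \<noteq> c 2 mod 3"
    "c 0 mod 3 \<noteq> c 3 mod 3" "c 1 mod 3 \<noteq> c 2 mod 3" "c 1 mod 3 \<noteq> c 3 mod 3" by blast+
  have "x mod 3 = 0 \<or> x mod 3 = 1 \<or> x mod 3 = 2" for x :: int by presburger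
  from this[of "c 0"] this[of "c 1"] this[of "c 2"] this[of "c 3"] show False
    using d by (elim disjE) simp_all
qed

lemma octa_push_chromatic: "push_chromatic {..<28} octa_edges = 4"
proof (rule antisym)
  note upper = push_chromatic_planar_girth_eight[OF octa_simple octa_planar octa_girth]
  show "push_chromatic {..<28} octa_edges \<le> 4" by (rule upper(2))
  obtain f where "twcol {..<28} (set octa_arcs) f"
    using planar_girth_eight_twcol[OF octa_simple octa_planar octa_girth octa_orientation] by blast
  \<comment> \<open>The \<open>LEAST\<close> is attained only if some size is feasible; the upper
    bound provides size 4.\<close>
  note hom = push_hom_if_twcol[OF this orientation_subset[OF octa_simple octa_orientation]]
  have "4 \<le> push_chromatic_or {..<28} (set octa_arcs)"
  proof (rule ccontr)
    assume less: "\<not> ?thesis"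
    obtain W :: "nat set" and B S f where W: "finite W" "card W = push_chromatic_or {..<28} (set octa_arcs)"
      "oriented_graph W B" "oriented_hom {..<28} (push S (set octa_arcs)) W B f"
      using LeastI[of "\<lambda>k. \<exists>(W :: nat set) B S f. finite W \<and> card W = k \<and> oriented_graph W B \<and>
        S \<subseteq> {..<28} \<and> oriented_hom {..<28} (push S (set octa_arcs)) W B f", OF hom]
      unfolding push_chromatic_or_def by blast
    then have "\<exists>c. \<forall>(u, v)\<in>set octa_arcs. hex_step (c u) (c v)"
      using less by (intro push_hom_hex[of W B]) auto
    then show False using octa_not_hex by blast
  qed
  also have "\<dots> \<le> push_chromatic {..<28} octa_edges"
    unfolding push_chromatic_def using octa_orientation by (intro Max_ge upper(1)) blast
  finally show "4 \<le> push_chromatic {..<28} octa_edges" .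
qed

theorem theorem5:
  shows "(\<forall>(V :: 'a set) E. simple_graph V E \<and> planar V E \<and> girth_at_least V E 8
            \<longrightarrow> push_chromatic V E \<le> 4) \<and>
         (\<exists>(V :: nat set) E. simple_graph V E \<and> planar V E \<and> girth_at_least V E 8
            \<and> push_chromatic V E = 4)"
  using push_chromatic_planar_girth_eight(2) octa_simple octa_planar octa_girth octa_push_chromatic
  by blast

end
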